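(* Let $Q=[-1,1]^2$ and let $W(F)=\frac12|F|^2+h_0(\det F)$ for $F\in\mathbb{R}^{2\times2}$. Assume that $h_0$ is strongly convex, $C^2$ where it is finite, satisfies (H1)--(H3) listed in the context, that for every $\mu>0$ there is $C_\mu>0$ such that $|h_0''(s)|\le C_\mu$ for all $s\in[\mu,+\infty)$, and in addition that $1+h_0'(1)\ne0$. Let $$I_s(\sigma)=\int_QW(\nabla u_\sigma)\,dx,\qquad \mathcal{A}_s=\{\sigma\in W^{1,2}(Q;\mathbb{R}):\ \sigma=0\text{ on }\partial Q_1,\ I_s(\sigma)<+\infty\},$$ where $\partial Q_1=\{(\pm1,t):-1\le t\le1\}$. Let $\sigma$ be the unique minimizer of $I_s$ in $\mathcal{A}_s$ and suppose there is a constant $c>0$ such that $1+\partial_2\sigma(x)\ge c$ for a.e. $x\in Q$. Then $\nabla\sigma$ is not continuous at the corners $(\pm1,\pm1)$ of $Q$.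
   Context: For a scalar function $\sigma$ on $Q$, the shear map is $u_\sigma(x)=x+\sigma(x)e_2$ with $e_2=(0,1)$, so $\nabla u_\sigma=\mathbf{1}+e_2\otimes\nabla\sigma$ and $\det\nabla u_\sigma=1+\partial_2\sigma$. Boundary conditions are in the sense of trace. A function $g$ with values in $(-\infty,+\infty]$ is strongly convex if $g-\frac\lambda2|\cdot|^2$ is convex for some $\lambda>0$. Hypotheses on $h_0:\mathbb{R}\to[0,+\infty]$: (H1) $h_0$ is convex and $h_0\ge0$; (H2) $h_0\in C^3((0,+\infty))$ and for some positive constants $s,c_1,c_2,d_0$: $c_1t^{-s-j}\le(-1)^jh_0^{(j)}(t)\le c_2t^{-s-j}$ for $0<t<d_0$ and $j=0,1,2$; (H3) $h_0(t)=+\infty$ for $t\le0$. *)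

theory Defs
  imports "HOL-Analysis.Analysis"
begin

section \<open>Extended-real-valued convex functions and the energy density\<close>

definition econvex :: "('a::real_vector \<Rightarrow> ereal) \<Rightarrow> bool" where
  "econvex g \<longleftrightarrow> (\<forall>x y. \<forall>u\<ge>0. \<forall>v\<ge>0. u + v = 1 \<longrightarrow>
     g (u *\<^sub>R x + v *\<^sub>R y) \<le> ereal u * g x + ereal v * g y)"

definition strongly_econvex :: "('a::real_normed_vector \<Rightarrow> ereal) \<Rightarrow> bool" where
  "strongly_econvex g \<longleftrightarrow> (\<exists>m>0. econvex (\<lambda>x. g x - ereal (m / 2 * (norm x)\<^sup>2)))"

definition Ck_on :: "nat \<Rightarrow> real set \<Rightarrow> (real \<Rightarrow> real) \<Rightarrow> bool" where
  "Ck_on k S f \<longleftrightarrow>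
     (\<forall>j<k. \<forall>t\<in>S. (deriv ^^ j) f field_differentiable (at t)) \<and>
     (\<forall>j\<le>k. continuous_on S ((deriv ^^ j) f))"

text \<open>The derivatives of an extended-real-valued function are those of its real part;
  they are only used where the function is finite.\<close>

definition ederiv :: "nat \<Rightarrow> (real \<Rightarrow> ereal) \<Rightarrow> real \<Rightarrow> real" where
  "ederiv j h = (deriv ^^ j) (\<lambda>t. real_of_ereal (h t))"

definition eCk_on :: "nat \<Rightarrow> real set \<Rightarrow> (real \<Rightarrow> ereal) \<Rightarrow> bool" where
  "eCk_on k S h \<longleftrightarrow> (\<forall>t\<in>S. \<bar>h t\<bar> \<noteq> \<infinity>) \<and> Ck_on k S (\<lambda>t. real_of_ereal (h t))"

definition H1 :: "(real \<Rightarrow> ereal) \<Rightarrow> bool" where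
  "H1 h \<longleftrightarrow> econvex h \<and> (\<forall>t. 0 \<le> h t)"

definition H2 :: "(real \<Rightarrow> ereal) \<Rightarrow> bool" where
  "H2 h \<longleftrightarrow> eCk_on 3 {0<..} h \<and>
     (\<exists>s c1 c2 d0. 0 < s \<and> 0 < c1 \<and> 0 < c2 \<and> 0 < d0 \<and>
       (\<forall>t. 0 < t \<and> t < d0 \<longrightarrow> (\<forall>j\<in>{0, 1, 2::nat}.
          c1 * t powr (- s - real j) \<le> (-1) ^ j * ederiv j h t \<and>
          (-1) ^ j * ederiv j h t \<le> c2 * t powr (- s - real j))))"

definition H3 :: "(real \<Rightarrow> ereal) \<Rightarrow> bool" where
  "H3 h \<longleftrightarrow> (\<forall>t\<le>0. h t = \<infinity>)"

text \<open>The norm on \<^typ>\<open>real^2^2\<close> is the Frobenius norm.\<close>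

definition W :: "(real \<Rightarrow> ereal) \<Rightarrow> real^2^2 \<Rightarrow> ereal" where
  "W h F = ereal (1 / 2 * (norm F)\<^sup>2) + h (det F)"


section \<open>Smooth functions, weak gradients and the Sobolev space\<close>

definition partial :: "'n \<Rightarrow> (real^'n \<Rightarrow> real) \<Rightarrow> real^'n \<Rightarrow> real" where
  "partial i f x = frechet_derivative f (at x) (axis i 1)"

definition grad :: "(real^'n \<Rightarrow> real) \<Rightarrow> real^'n \<Rightarrow> real^'n" where
  "grad f x = (\<chi> i. partial i f x)"

text \<open>\<open>C\<^sup>\<infinity>\<close> on the whole space: differentiability of all iterated partial derivatives
  also gives their continuity.\<close>

definition smooth :: "(real^'n \<Rightarrow> real) \<Rightarrow> bool" where
  "smooth f \<longleftrightarrow> (\<forall>is x. fold partial is f differentiable (at x))"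

definition test_function :: "(real^'n) set \<Rightarrow> (real^'n \<Rightarrow> real) \<Rightarrow> bool" where
  "test_function \<Omega> \<phi> \<longleftrightarrow> smooth \<phi> \<and>
     compact (closure {x. \<phi> x \<noteq> 0}) \<and> closure {x. \<phi> x \<noteq> 0} \<subseteq> \<Omega>"

definition L1_loc :: "(real^'n) set \<Rightarrow> (real^'n \<Rightarrow> 'b::euclidean_space) \<Rightarrow> bool" where
  "L1_loc \<Omega> f \<longleftrightarrow> (\<forall>K. compact K \<and> K \<subseteq> \<Omega> \<longrightarrow> integrable (lebesgue_on K) f)"

definition L2 :: "(real^'n) set \<Rightarrow> (real^'n \<Rightarrow> 'b::euclidean_space) \<Rightarrow> bool" where
  "L2 \<Omega> f \<longleftrightarrow> f \<in> borel_measurable (lebesgue_on \<Omega>) \<and>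
     integrable (lebesgue_on \<Omega>) (\<lambda>x. (norm (f x))\<^sup>2)"

definition has_weak_gradient ::
    "(real^'n) set \<Rightarrow> (real^'n \<Rightarrow> real) \<Rightarrow> (real^'n \<Rightarrow> real^'n) \<Rightarrow> bool" where
  "has_weak_gradient \<Omega> f G \<longleftrightarrow> L1_loc \<Omega> f \<and> L1_loc \<Omega> G \<and>
     (\<forall>\<phi>. test_function \<Omega> \<phi> \<longrightarrow> (\<forall>i.
        (LINT x|lebesgue_on \<Omega>. f x * partial i \<phi> x) =
        - (LINT x|lebesgue_on \<Omega>. G x $ i * \<phi> x)))"

text \<open>Elements of Sobolev spaces are represented by functions defined everywhere;
  weak gradients are determined up to null sets only, and \<open>wgrad\<close> picks one of them.\<close>

definition wgrad :: "(real^'n) set \<Rightarrow> (real^'n \<Rightarrow> real) \<Rightarrow> real^'n \<Rightarrow> real^'n" where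
  "wgrad \<Omega> f = (SOME G. has_weak_gradient \<Omega> f G)"

definition W12 :: "(real^'n) set \<Rightarrow> (real^'n \<Rightarrow> real) set" where
  "W12 \<Omega> = {f. L2 \<Omega> f \<and> (\<exists>G. has_weak_gradient \<Omega> f G \<and> L2 \<Omega> G)}"


section \<open>The square and traces on its boundary\<close>

definition Q :: "(real^2) set" where
  "Q = cbox (vector [-1, -1]) (vector [1, 1])"

definition bdryQ1 :: "(real^2) set" where
  "bdryQ1 = {vector [a, t] | a t. a \<in> {-1, 1} \<and> -1 \<le> t \<and> t \<le> 1}"

definition corners :: "(real^2) set" where
  "corners = {vector [a, b] | a b. a \<in> {-1, 1} \<and> b \<in> {-1, 1}}"

text \<open>For \<open>a = \<plusminus>1\<close> this parametrizes by arc length, over \<open>t \<in> [-1, 1]\<close>, the side of \<open>Q\<close>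
  on which the \<open>i\<close>-th coordinate equals \<open>a\<close>.\<close>

definition side :: "2 \<Rightarrow> real \<Rightarrow> real \<Rightarrow> real^2" where
  "side i a t = (\<chi> j. if j = i then a else t)"

text \<open>The trace operator is the continuous extension to \<open>W\<^sup>1\<^sup>,\<^sup>2(Q)\<close>, with values in
  \<open>L\<^sup>2(\<partial>Q)\<close>, of the restriction map on functions that are smooth up to the boundary.\<close>

definition has_trace :: "(real^2 \<Rightarrow> real) \<Rightarrow> (real^2 \<Rightarrow> real) \<Rightarrow> bool" where
  "has_trace f \<tau> \<longleftrightarrow> \<tau> \<in> borel_measurable borel \<and>
     (\<exists>\<phi>. (\<forall>n::nat. smooth (\<phi> n)) \<and>
       (\<lambda>n. \<integral>\<^sup>+x\<in>Q. ennreal ((\<phi> n x - f x)\<^sup>2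
              + (norm (grad (\<phi> n) x - wgrad (interior Q) f x))\<^sup>2) \<partial>lebesgue)
         \<longlonglongrightarrow> 0 \<and>
       (\<lambda>n. \<Sum>i\<in>UNIV. \<Sum>a\<in>{-1, 1}.
              \<integral>\<^sup>+t\<in>{-1..1}. ennreal ((\<phi> n (side i a t) - \<tau> (side i a t))\<^sup>2) \<partial>lborel)
         \<longlonglongrightarrow> 0)"

text \<open>Vanishing of the trace almost everywhere, with respect to arc length, on a subset
  of the boundary.\<close>

definition zero_trace_on :: "(real^2) set \<Rightarrow> (real^2 \<Rightarrow> real) \<Rightarrow> bool" where
  "zero_trace_on \<Gamma> f \<longleftrightarrow> (\<exists>\<tau>. has_trace f \<tau> \<and>
     (\<forall>i. \<forall>a\<in>{-1, 1}. AE t in lborel. t \<in> {-1..1} \<and> side i a t \<in> \<Gamma> \<longrightarrow> \<tau> (side i a t) = 0))"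


section \<open>The variational problem for shear maps\<close>

definition shear :: "(real^2 \<Rightarrow> real) \<Rightarrow> real^2 \<Rightarrow> real^2" where
  "shear \<sigma> x = x + \<sigma> x *\<^sub>R axis 2 1"

definition wjacobian :: "(real^2) set \<Rightarrow> (real^2 \<Rightarrow> real^2) \<Rightarrow> real^2 \<Rightarrow> real^2^2" where
  "wjacobian \<Omega> u x = (\<chi> i. wgrad \<Omega> (\<lambda>y. u y $ i) x)"

text \<open>\<^const>\<open>W\<close> is nonnegative under \<^const>\<open>H1\<close>, so that \<^const>\<open>e2ennreal\<close> loses nothing.\<close>

definition shear_energy :: "(real \<Rightarrow> ereal) \<Rightarrow> (real^2 \<Rightarrow> real) \<Rightarrow> ennreal" where
  "shear_energy h \<sigma> =
     (\<integral>\<^sup>+x\<in>Q. e2ennreal (W h (wjacobian (interior Q) (shear \<sigma>) x)) \<partial>lebesgue)"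

definition admissible :: "(real \<Rightarrow> ereal) \<Rightarrow> (real^2 \<Rightarrow> real) set" where
  "admissible h =
     {\<sigma> \<in> W12 (interior Q). zero_trace_on bdryQ1 \<sigma> \<and> shear_energy h \<sigma> < \<infinity>}"

end

theory Submission
  imports Defs
begin

text \<open>
  Suppose that near a corner \<open>p\<close> the gradient of \<open>\<sigma>\<close> is close to a vector \<open>L\<close>. Since \<open>\<sigma>\<close> vanishes on
  the vertical side through \<open>p\<close>, integrating \<open>\<partial>\<^sub>2 \<sigma>\<close> by parts in the second variable over a box that is
  much thinner in the first variable gives \<open>L\<^sub>2 = 0\<close>. The horizontal side, on the other hand, is free,
  so \<open>\<sigma>\<close> may be perturbed there. For a bump \<open>\<psi>\<close> in a box of side length \<open>r\<close> at \<open>p\<close> that vanishes on the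
  vertical side, with gradient bounded independently of \<open>r\<close>, the energy changes under \<open>\<sigma> + s \<psi>\<close> by
  \<open>s \<integral> (L\<^sub>1 \<partial>\<^sub>1 \<psi> + (1 + h\<^sub>0'(1)) \<partial>\<^sub>2 \<psi>)\<close> up to \<open>(o(1) + O(s)) s r\<^sup>2\<close>. The first term integrates to \<open>0\<close>, and the
  second to a multiple of \<open>r\<^sup>2 (1 + h\<^sub>0'(1))\<close> coming from the free side, so if \<open>1 + h\<^sub>0'(1) \<noteq> 0\<close> then a
  suitable sign of \<open>s\<close> lowers the energy.
\<close>

section \<open>Smooth functions\<close>

text \<open>A trace is given only through smooth functions that approximate \<open>\<sigma>\<close>
  in W^{1,2} and on the boundary; \<open>\<sigma>\<close> itself cannot be evaluated on a side.
  Hence the bound on \<open>L $ 2\<close> is proved for smooth functions, with the mean errors of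
  the gradient and of the boundary values kept explicit, and passed to the limit afterwards. The
  boxes have to be thin because \<open>L $ 1\<close> is arbitrary: across a width d the function may
  grow by |L_1| d, which is negligible against a vertical variation |L_2| e only if d is much
  smaller than e.

  The equation L_2 = 0 enters the second half as well. It makes the determinant nearly 1 close to
  the corner, so that \<open>h\<^sub>0\<close> is finite and differentiable along the perturbation,
  with slope close to h_0'(1). Energies are integrals of extended values, so the increment on the
  box is split into its positive and negative part instead of subtracting energies.

  \<open>wgrad\<close> is an arbitrary choice among weak gradients, so their uniqueness up to null
  sets underlies every computation with it.\<close>

lemma partial_eqI: "(f has_derivative f') (at x) \<Longrightarrow> partial i f x = f' (axis i 1)"
  unfolding partial_def using frechet_derivative_at by metis

text \<open>\<open>smooth\<close> speaks of all finite words of partial derivatives, so induction on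
  the word applies to any family of differentiable functions that is closed under
  \<open>partial\<close>. A proof of smoothness then only has to exhibit such a family.\<close>

lemma smooth_coinduct:
  assumes "f \<in> S" "\<And>f x. f \<in> S \<Longrightarrow> f differentiable (at x)"
    and "\<And>f i. f \<in> S \<Longrightarrow> partial i f \<in> S"
  shows "smooth f"
proof -
  have "fold partial is f \<in> S" for "is"
    using assms(1,3) by (induction "is" arbitrary: f) auto
  then show ?thesis using assms(2) by (auto simp: smooth_def)
qed

lemma smooth_differentiable: "smooth f \<Longrightarrow> f differentiable (at x)"
  unfolding smooth_def by (metis fold_simps(1))

lemma smooth_partial: "smooth f \<Longrightarrow> smooth (partial i f)"
  unfolding smooth_def by (metis fold_simps(2))

lemma smooth_continuous_on: "smooth f \<Longrightarrow> continuous_on S f"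
  by (meson differentiable_imp_continuous_on differentiable_at_imp_differentiable_on
      smooth_differentiable)

lemma partial_add:
  "\<lbrakk>f differentiable (at x); g differentiable (at x)\<rbrakk> \<Longrightarrow>
    partial i (\<lambda>x. f x + g x) x = partial i f x + partial i g x"
  using partial_eqI[OF has_derivative_add] by (simp add: frechet_derivative_works partial_def)

lemma partial_mult:
  fixes f g :: "real^'n \<Rightarrow> real"
  assumes "f differentiable (at x)" "g differentiable (at x)"
  shows "partial i (\<lambda>x. f x * g x) x = f x * partial i g x + partial i f x * g x"
  using assms by (auto simp: frechet_derivative_works partial_def
      intro!: partial_eqI[unfolded partial_def, THEN trans] has_derivative_mult)

lemma smooth_const: "smooth (\<lambda>x. c)"
proof (rule smooth_coinduct[where S = "range (\<lambda>c x. c)"])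
  fix f :: "real^'n \<Rightarrow> real" and i assume "f \<in> range (\<lambda>c x. c)"
  then obtain c where "f = (\<lambda>x. c)" by auto
  then have "partial i f = (\<lambda>x. 0)" by (auto simp: partial_def)
  then show "partial i f \<in> range (\<lambda>c x. c)" by auto
qed auto

lemma smooth_add:
  assumes "smooth f" "smooth g"
  shows "smooth (\<lambda>x. f x + g x)"
proof (rule smooth_coinduct[where S = "{\<lambda>x. f x + g x | f g. smooth f \<and> smooth g}"])
  fix h :: "real^'n \<Rightarrow> real" and i x
  assume "h \<in> {\<lambda>x. f x + g x | f g. smooth f \<and> smooth g}"
  then obtain f g where fg: "h = (\<lambda>x. f x + g x)" "smooth f" "smooth g" by auto
  have "partial i h = (\<lambda>x. partial i f x + partial i g x)"
    using fg by (auto simp: partial_add smooth_differentiable)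
  then show "partial i h \<in> {\<lambda>x. f x + g x | f g. smooth f \<and> smooth g}"
    using fg smooth_partial by blast
  show "h differentiable at x"
    unfolding fg(1) using fg by (intro differentiable_add smooth_differentiable)
qed (use assms in auto)

text \<open>Sums of products of smooth functions are closed under partial derivatives.\<close>

inductive_set sum_of_products :: "(real^'n \<Rightarrow> real) set" where
  product: "smooth f \<Longrightarrow> smooth g \<Longrightarrow> (\<lambda>x. f x * g x) \<in> sum_of_products"
| add: "f \<in> sum_of_products \<Longrightarrow> g \<in> sum_of_products \<Longrightarrow> (\<lambda>x. f x + g x) \<in> sum_of_products"

lemma smooth_mult:
  assumes "smooth f" "smooth g"
  shows "smooth (\<lambda>x. f x * g x)"
proof (rule smooth_coinduct[where S = sum_of_products])
  show diff: "h differentiable at x" if "h \<in> sum_of_products" for h :: "real^'n \<Rightarrow> real" and x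
    using that by induction (auto intro: differentiable_mult smooth_differentiable)
  show "partial i h \<in> sum_of_products" if "h \<in> sum_of_products" for h :: "real^'n \<Rightarrow> real" and i
    using that
  proof induction
    case (product f g)
    have "partial i (\<lambda>x. f x * g x) = (\<lambda>x. f x * partial i g x + partial i f x * g x)"
      using product by (auto simp: partial_mult smooth_differentiable)
    then show ?case
      using product by (auto intro!: sum_of_products.intros smooth_partial)
  next
    case (add f g)
    then have "partial i (\<lambda>x. f x + g x) = (\<lambda>x. partial i f x + partial i g x)"
      by (auto simp: partial_add diff)
    then show ?case using add by (auto intro!: sum_of_products.intros)
  qed
qed (use assms in \<open>auto intro: sum_of_products.product\<close>)

lemma smooth_cmult: "smooth f \<Longrightarrow> smooth (\<lambda>x. c * f x)"
  by (rule smooth_mult[OF smooth_const])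

lemma smooth_prod:
  "finite I \<Longrightarrow> (\<And>i. i \<in> I \<Longrightarrow> smooth (f i)) \<Longrightarrow> smooth (\<lambda>x. \<Prod>i\<in>I. f i x)"
  by (induction I rule: finite_induct) (auto intro: smooth_const smooth_mult)

lemma partial_component: "partial i (\<lambda>x. x $ j) x = (if i = j then 1 else 0)"
proof -
  have "((\<lambda>x. x $ j) has_derivative (\<lambda>h. h $ j)) (at x)"
    by (intro bounded_linear_imp_has_derivative bounded_linear_vec_nth)
  from partial_eqI[OF this] show ?thesis by (simp add: axis_def)
qed

lemma smooth_component: "smooth (\<lambda>x :: real^'n. x $ j)"
proof (rule smooth_coinduct[where S = "insert (\<lambda>x. x $ j) (range (\<lambda>c x. c))"])
  fix f :: "real^'n \<Rightarrow> real" and i x assume f: "f \<in> insert (\<lambda>x. x $ j) (range (\<lambda>c x. c))"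
  then show "partial i f \<in> insert (\<lambda>x. x $ j) (range (\<lambda>c x. c))"
  proof
    assume "f = (\<lambda>x. x $ j)"
    then have "partial i f = (\<lambda>x. if i = j then 1 else 0)" by (auto simp: partial_component)
    then show ?thesis by auto
  next
    assume "f \<in> range (\<lambda>c x. c)"
    then obtain c where "f = (\<lambda>x. c)" by auto
    then have "partial i f = (\<lambda>x. 0)" by (auto simp: partial_def)
    then show ?thesis by auto
  qed
  from f show "f differentiable at x"
    by (auto simp: bounded_linear_imp_differentiable bounded_linear_vec_nth)
qed auto

section \<open>The flat function exp(-1/x) and its derivatives\<close>

definition flat :: "real poly \<Rightarrow> real \<Rightarrow> real" where
  "flat p x = (if x > 0 then poly p (1 / x) * exp (- (1 / x)) else 0)"

lemma poly_exp_neg_tendsto_0: "((\<lambda>u::real. poly p u * exp (- u)) \<longlongrightarrow> 0) at_top"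
proof -
  have *: "((\<lambda>u::real. \<Sum>i\<le>degree p. coeff p i * (u ^ i / exp u)) \<longlongrightarrow>
      (\<Sum>i\<le>degree p. coeff p i * 0)) at_top"
    by (intro tendsto_intros tendsto_power_div_exp_0)
  have "(\<Sum>i\<le>degree p. coeff p i * (u ^ i / exp u)) = poly p u * exp (- u)" for u :: real
    unfolding poly_altdef sum_distrib_right exp_minus divide_inverse mult.assoc ..
  with * show ?thesis by simp
qed

text \<open>Differentiating p(1/x) exp(-1/x) gives (1/x)^2 (p - p')(1/x) exp(-1/x). This is why a
  polynomial factor is carried along: the functions \<open>flat p\<close> are closed under
  derivatives. The only delicate point is x = 0.\<close>

lemma has_real_derivative_flat:
  "(flat p has_real_derivative flat ([:0, 0, 1:] * (p - pderiv p)) x) (at x)"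
proof (cases "x = 0")
  case False
  show ?thesis
  proof (cases "x > 0")
    case True
    have "((\<lambda>x. poly p (1 / x) * exp (- (1 / x))) has_real_derivative
        flat ([:0, 0, 1:] * (p - pderiv p)) x) (at x)"
      using True
      by (auto intro!: derivative_eq_intros DERIV_chain'[where g = "poly p"] poly_DERIV
          simp: flat_def field_simps power2_eq_square)
    then show ?thesis
    proof (rule has_field_derivative_transform_within_open[where S = "{0<..}"])
    qed (use True in \<open>auto simp: flat_def\<close>)
  next
    case False
    have "((\<lambda>x. 0) has_real_derivative flat ([:0, 0, 1:] * (p - pderiv p)) x) (at x)"
      using False by (auto simp: flat_def)
    then show ?thesis
    proof (rule has_field_derivative_transform_within_open[where S = "{..<0}"])
    qed (use False \<open>x \<noteq> 0\<close> in \<open>auto simp: flat_def\<close>)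
  qed
next
  case True
  have "((\<lambda>h. flat p h / h) \<longlongrightarrow> 0) (at 0)"
  proof -
    \<comment> \<open>Dividing by h multiplies the polynomial by its variable: with u = 1/h, the
      quotient \<open>flat p h / h\<close> is u p(u) exp(-u).\<close>
    have "((\<lambda>h::real. poly ([:0, 1:] * p) (inverse h) * exp (- (inverse h))) \<longlongrightarrow> 0) (at_right 0)"
      by (rule filterlim_compose[OF poly_exp_neg_tendsto_0 filterlim_inverse_at_top_right])
    moreover have "\<forall>\<^sub>F h in at_right 0. poly ([:0, 1:] * p) (inverse h) * exp (- (inverse h)) = flat p h / h"
      by (auto simp: eventually_at_filter flat_def field_simps)
    ultimately have r: "((\<lambda>h. flat p h / h) \<longlongrightarrow> 0) (at_right 0)"
      using tendsto_cong by fast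
    have l: "((\<lambda>h. flat p h / h) \<longlongrightarrow> 0) (at_left 0)"
      by (rule tendsto_eventually) (auto simp: eventually_at_filter flat_def)
    show ?thesis using l r by (simp add: filterlim_split_at)
  qed
  then show ?thesis using True by (simp add: DERIV_def flat_def)
qed

lemma has_derivative_comp_component:
  assumes "(a has_real_derivative d) (at (x $ i))"
  shows "((\<lambda>x. a (x $ i)) has_derivative (\<lambda>h. d * h $ i)) (at x)"
  using has_derivative_compose[OF bounded_linear_imp_has_derivative[OF bounded_linear_vec_nth]
      assms[unfolded has_field_derivative_def]] by auto

lemma smooth_flat: "smooth (\<lambda>x :: real^'n. flat p (k * x $ i + m))"
\<comment> \<open>The scalar \<open>c\<close> absorbs the factor \<open>k\<close> of the chain rule,
  and it becomes 0 for a derivative in another coordinate direction.\<close>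
proof (rule smooth_coinduct[where S = "{\<lambda>x. c * flat p (k * x $ i + m) | c p. True}"])
  fix f :: "real^'n \<Rightarrow> real" and j x
  assume "f \<in> {\<lambda>x. c * flat p (k * x $ i + m) | c p. True}"
  then obtain c p where f: "f = (\<lambda>x. c * flat p (k * x $ i + m))" by auto
  let ?p = "[:0, 0, 1:] * (p - pderiv p)"
  have "((\<lambda>t. c * flat p (k * t + m)) has_real_derivative (c * k * flat ?p (k * t + m))) (at t)" for t
    by (auto intro!: derivative_eq_intros DERIV_chain2[OF has_real_derivative_flat])
  from has_derivative_comp_component[OF this]
  have d: "(f has_derivative (\<lambda>h. (c * k * flat ?p (k * x $ i + m)) * h $ i)) (at x)" for x
    unfolding f .
  then show "f differentiable at x" using differentiable_def by blast
  have "partial j f = (\<lambda>x. (if j = i then c * k else 0) * flat ?p (k * x $ i + m))"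
    by (rule ext, subst partial_eqI[OF d]) (simp add: axis_def)
  then show "partial j f \<in> {\<lambda>x. c * flat p (k * x $ i + m) | c p. True}" by blast
qed (auto intro!: exI[of _ 1] exI[of _ p])

section \<open>Weak gradients\<close>

text \<open>Open boxes are an intersection-stable generator of the Borel sets, and the sets over
  which \<open>f\<close> integrates to 0 form a Dynkin system. So \<open>f\<close> and 0 have the
  same integral over every Borel set and agree almost everywhere.\<close>

lemma AE_0_if_box_integrals_0:
  fixes f :: "'a::euclidean_space \<Rightarrow> real"
  assumes f: "integrable lborel f"
    and box: "\<And>l u. (LINT x:box l u|lborel. f x) = 0"
  shows "AE x in lborel. f x = 0"
proof (rule density_unique_real[OF f integrable_zero])
  fix A :: "'a set" assume "A \<in> sets lborel"
  then have A: "A \<in> sigma_sets UNIV (range (\<lambda>(a, b). box a b))"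
    by (simp add: borel_eq_box)
  have sint: "set_integrable lborel B f" if "B \<in> sets lborel" for B
    unfolding set_integrable_def using that f by (rule integrable_mult_indicator)
  \<comment> \<open>Complements require the whole space, which is not a box but an increasing union
    of boxes.\<close>
  have univ: "(LINT x:UNIV|lborel. f x) = 0"
  proof -
    let ?B = "\<lambda>n::nat. box (- real n *\<^sub>R One) (real n *\<^sub>R One) :: 'a set"
    have "(\<lambda>n. LINT x:?B n|lborel. f x) \<longlonglongrightarrow> (LINT x:(\<Union>n. ?B n)|lborel. f x)"
    proof (rule set_integral_cont_up)
      show "incseq ?B" by (auto simp: incseq_def intro!: subset_box_imp)
    qed (auto intro: sint)
    then have "(LINT x:(\<Union>n. ?B n)|lborel. f x) = 0"
      using box by (simp add: LIMSEQ_const_iff)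
    then show ?thesis by (simp add: UN_box_eq_UNIV)
  qed
  have "Int_stable (range (\<lambda>(a, b). box a b :: 'a set))"
    by (auto simp: Int_stable_def box_Int_box)
  moreover have "range (\<lambda>(a, b). box a b) \<subseteq> Pow (UNIV :: 'a set)" by auto
  ultimately have "(LINT x:A|lborel. f x) = 0"
    using A
  proof (induction rule: sigma_sets_induct_disjoint)
    case (compl A)
    then have "A \<in> sets lborel" by (simp add: borel_eq_box)
    moreover from this have "UNIV - A \<in> sets lborel" by auto
    ultimately have "(LINT x:A \<union> (UNIV - A)|lborel. f x)
        = (LINT x:A|lborel. f x) + (LINT x:(UNIV - A)|lborel. f x)"
      by (intro set_integral_Un sint) auto
    then show ?case using compl univ by simp
  next
    case (union A)
    then have "range A \<subseteq> sets lborel" by (simp add: borel_eq_box)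
    then have "(LINT x:(\<Union>i. A i)|lborel. f x) = (\<Sum>i. (LINT x:(A i)|lborel. f x))"
      using union(1) by (intro lebesgue_integral_countable_add sint) (auto simp: disjoint_family_on_def)
    then show ?case using union by simp
  next
    case (basic A)
    then show ?case using box by auto
  qed (simp add: set_lebesgue_integral_def)
  then show "(LINT x:A|lborel. f x) = (LINT x:A|lborel. 0)" by simp
qed

lemma L1_loc_iff:
  "L1_loc \<Omega> f \<longleftrightarrow> (\<forall>K. compact K \<and> K \<subseteq> \<Omega> \<longrightarrow> set_integrable lebesgue K f)"
  unfolding L1_loc_def set_integrable_def
  by (intro all_cong1 imp_cong refl integrable_restrict_space)
     (auto simp: borel_closed compact_imp_closed)

text \<open>For t > 0 the factor exp(-1/(k t)) tends to 1 as k grows, and for t <= 0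
  \<open>flat\<close> is 0. These smooth functions with values in [0, 1] therefore converge
  pointwise to the indicator of the open box.\<close>

definition cutoff :: "real^'n \<Rightarrow> real^'n \<Rightarrow> real \<Rightarrow> real^'n \<Rightarrow> real" where
  "cutoff l u k x = (\<Prod>i\<in>UNIV. flat 1 (k * (x $ i - l $ i)) * flat 1 (k * (u $ i - x $ i)))"

lemma smooth_cutoff: "smooth (cutoff l u k)"
proof -
  have "cutoff l u k = (\<lambda>x. \<Prod>i\<in>UNIV. flat 1 (k * x $ i + - k * l $ i) * flat 1 ((- k) * x $ i + k * u $ i))"
    by (auto simp: cutoff_def fun_eq_iff algebra_simps)
  then show ?thesis
    by (simp only:) (intro smooth_prod smooth_mult smooth_flat finite)
qed

lemma flat_1_bounds: "0 \<le> flat 1 x" "flat 1 x \<le> 1"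
  by (auto simp: flat_def)

lemma cutoff_bounds: "0 \<le> cutoff l u k x" "cutoff l u k x \<le> 1"
  unfolding cutoff_def using flat_1_bounds
  by (auto intro!: prod_nonneg prod_le_1 mult_nonneg_nonneg mult_le_one)

lemma cutoff_eq_0: "k > 0 \<Longrightarrow> x \<notin> box l u \<Longrightarrow> cutoff l u k x = 0"
  by (force simp: cutoff_def mem_box_cart flat_def zero_less_mult_iff)

lemma cutoff_tendsto_1:
  assumes "x \<in> box l u"
  shows "(\<lambda>n. cutoff l u (real (Suc n)) x) \<longlonglongrightarrow> 1"
proof -
  have flat: "(\<lambda>n. flat 1 (real (Suc n) * t)) \<longlonglongrightarrow> 1" if "t > 0" for t
  proof -
    have "(\<lambda>n. exp (- (inverse (real (Suc n)) * (1 / t)))) \<longlonglongrightarrow> exp (- (0 * (1 / t)))"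
      by (intro tendsto_intros LIMSEQ_inverse_real_of_nat)
    moreover have "flat 1 (real (Suc n) * t) = exp (- (inverse (real (Suc n)) * (1 / t)))" for n
      using that by (simp add: flat_def inverse_eq_divide)
    ultimately show ?thesis by simp
  qed
  have "(\<lambda>n. cutoff l u (real (Suc n)) x) \<longlonglongrightarrow> (\<Prod>i::'a\<in>UNIV. 1 * 1)"
    unfolding cutoff_def
    using assms by (intro tendsto_intros flat) (auto simp: mem_box_cart)
  then show ?thesis by simp
qed

lemma test_function_cutoff:
  assumes "cbox l u \<subseteq> \<Omega>" "k > 0"
  shows "test_function \<Omega> (cutoff l u k)"
proof -
  have "closure {x. cutoff l u k x \<noteq> 0} \<subseteq> cbox l u"
  proof (rule closure_minimal)
    show "{x. cutoff l u k x \<noteq> 0} \<subseteq> cbox l u"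
      using cutoff_eq_0[OF assms(2)] box_subset_cbox by blast
  qed (rule closed_cbox)
  then show ?thesis
    unfolding test_function_def using smooth_cutoff assms(1)
    by (meson bounded_cbox bounded_subset closed_closure compact_eq_bounded_closed dual_order.trans)
qed

lemma AE_lebesgue_on_iff:
  "S \<in> sets lebesgue \<Longrightarrow> (AE x in lebesgue_on S. P x) \<longleftrightarrow> (AE x in lebesgue. x \<in> S \<longrightarrow> P x)"
  by (rule AE_restrict_space_iff) simp

text \<open>The cutoffs are test functions that converge to the indicator of the box. The
  restriction of \<open>f\<close> to the box dominates the products, so the vanishing integrals pass
  to the limit.\<close>

lemma integral_box_eq_0_if_test:
  assumes L1: "L1_loc \<Omega> f" and "open \<Omega>"
    and test: "\<And>\<phi>. test_function \<Omega> \<phi> \<Longrightarrow> (LINT x|lebesgue_on \<Omega>. f x * \<phi> x) = 0"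
    and K: "cbox l u \<subseteq> \<Omega>"
  shows "(LINT x:box l u|lebesgue. f x) = 0"
proof -
  have int: "set_integrable lebesgue (cbox l u) f"
    using L1 K by (simp add: L1_loc_iff)
  have box: "set_integrable lebesgue (box l u) f"
    by (rule set_integrable_subset[OF int]) (auto simp: box_subset_cbox)
  let ?c = "\<lambda>n. cutoff l u (real (Suc n))"
  have "(\<lambda>n. LINT x|lebesgue. ?c n x * (indicator (box l u) x *\<^sub>R f x)) \<longlonglongrightarrow>
      (LINT x|lebesgue. indicator (box l u) x *\<^sub>R f x)"
  proof (rule integral_dominated_convergence)
    show "integrable lebesgue (\<lambda>x. norm (indicator (box l u) x *\<^sub>R f x))"
      using box unfolding set_integrable_def by (rule integrable_norm)
    show m: "(\<lambda>x. indicator (box l u) x *\<^sub>R f x) \<in> borel_measurable lebesgue"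
      using box unfolding set_integrable_def by simp
    show "(\<lambda>x. ?c n x * (indicator (box l u) x *\<^sub>R f x)) \<in> borel_measurable lebesgue" for n
      by (intro borel_measurable_times m measurable_completion)
         (auto intro!: borel_measurable_continuous_onI smooth_continuous_on smooth_cutoff)
    show "AE x in lebesgue. (\<lambda>n. ?c n x * (indicator (box l u) x *\<^sub>R f x))
        \<longlonglongrightarrow> indicator (box l u) x *\<^sub>R f x"
    proof (rule AE_I2)
      fix x
      show "(\<lambda>n. ?c n x * (indicator (box l u) x *\<^sub>R f x)) \<longlonglongrightarrow> indicator (box l u) x *\<^sub>R f x"
      proof (cases "x \<in> box l u")
        case True
        show ?thesis using tendsto_mult[OF cutoff_tendsto_1[OF True] tendsto_const] by simp
      qed auto
    qed
    show "AE x in lebesgue. norm (?c n x * (indicator (box l u) x *\<^sub>R f x))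
        \<le> norm (indicator (box l u) x *\<^sub>R f x)" for n
      using cutoff_bounds[of l u "real (Suc n)"]
      by (intro AE_I2) (simp add: abs_mult mult_left_le_one_le)
  qed
  moreover have "(LINT x|lebesgue. ?c n x * (indicator (box l u) x *\<^sub>R f x)) = 0" for n
  proof -
    have "(LINT x|lebesgue. ?c n x * (indicator (box l u) x *\<^sub>R f x))
        = (LINT x|lebesgue. indicator \<Omega> x *\<^sub>R (f x * ?c n x))"
      using cutoff_eq_0[of "real (Suc n)" _ l u] K box_subset_cbox[of l u]
      by (intro Bochner_Integration.integral_cong) (auto simp: indicator_def)
    also have "\<dots> = (LINT x|lebesgue_on \<Omega>. f x * ?c n x)"
      using \<open>open \<Omega>\<close> by (subst integral_restrict_space) auto
    finally show ?thesis using test[OF test_function_cutoff[OF K]] by simp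
  qed
  ultimately show ?thesis
    unfolding set_lebesgue_integral_def by (simp add: LIMSEQ_const_iff)
qed

text \<open>An open set is a countable union of closed boxes, so one closed box inside it suffices.
  There \<open>f\<close>, cut off to the open box, integrates to 0 over every box, because an
  intersection of two boxes is a box.\<close>

lemma fundamental_lemma:
  fixes \<Omega> :: "(real^'n) set"
  assumes L1: "L1_loc \<Omega> f" and "open \<Omega>"
    and test: "\<And>\<phi>. test_function \<Omega> \<phi> \<Longrightarrow> (LINT x|lebesgue_on \<Omega>. f x * \<phi> x) = 0"
  shows "AE x in lebesgue_on \<Omega>. f x = (0::real)"
proof -
  have cbox: "AE x in lebesgue. x \<in> cbox l u \<longrightarrow> f x = 0" if K: "cbox l u \<subseteq> \<Omega>" for l u
  proof -
    let ?F = "\<lambda>x. indicator (box l u) x * f x"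
    have "set_integrable lebesgue (cbox l u) f"
      using L1 K by (simp add: L1_loc_iff)
    then have "set_integrable lebesgue (box l u) f"
      by (rule set_integrable_subset) (auto simp: box_subset_cbox)
    then have F: "integrable lebesgue ?F" by (simp add: set_integrable_def)
    \<comment> \<open>A Borel representative is needed because the criterion on box integrals
      concerns \<open>lborel\<close>, whereas \<open>f\<close> is only Lebesgue measurable.\<close>
    then obtain g where g: "g \<in> borel_measurable lborel" "AE x in lborel. ?F x = g x"
      using completion_ex_borel_measurable_real by blast
    have "integrable lebesgue g"
      using AE_completion[OF g(2)]
      by (intro integrable_cong_AE_imp[OF F] measurable_completion g(1)) auto
    then have g': "integrable lborel g" using g(1) by (simp add: integrable_completion)
    have "AE x in lborel. g x = 0"
    proof (rule AE_0_if_box_integrals_0[OF g'])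
      fix l' u' :: "real^'n"
      obtain a b where ab: "box l' u' \<inter> box l u = box a b" using box_Int_box by blast
      have "(LINT x:box a b|lebesgue. f x) = 0"
      \<comment> \<open>If the open box is empty, \<open>cbox a b\<close> may be degenerate without
        being empty and need not lie in \<open>\<Omega>\<close>.\<close>
      proof (cases "box a b = {}")
        case False
        then have "cbox a b = closure (box a b)" by (simp add: closure_box)
        also have "\<dots> \<subseteq> closure (box l u)" by (intro closure_mono) (use ab in auto)
        also have "\<dots> \<subseteq> cbox l u" by (rule closure_minimal[OF box_subset_cbox closed_cbox])
        finally have "cbox a b \<subseteq> \<Omega>" using K by blast
        then show ?thesis 
          by (intro integral_box_eq_0_if_test[OF L1 \<open>open \<Omega>\<close>] test)
      qed (simp add: set_lebesgue_integral_def)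
      moreover have "(LINT x:box l' u'|lborel. g x) = (LINT x:box l' u'|lebesgue. g x)"
        unfolding set_lebesgue_integral_def using g(1)
        by (intro integral_completion[symmetric]) auto
      moreover have "(LINT x:box l' u'|lebesgue. g x) = (LINT x:box l' u'|lebesgue. ?F x)"
        unfolding set_lebesgue_integral_def
      proof (rule integral_cong_AE)
        show "AE x in lebesgue. indicator (box l' u') x *\<^sub>R g x = indicator (box l' u') x *\<^sub>R ?F x"
          using AE_completion[OF g(2)] by eventually_elim simp
        show "(\<lambda>x. indicator (box l' u') x *\<^sub>R g x) \<in> borel_measurable lebesgue"
          using g(1) by (auto intro!: measurable_completion borel_measurable_scaleR)
        show "(\<lambda>x. indicator (box l' u') x *\<^sub>R ?F x) \<in> borel_measurable lebesgue"
          by (intro borel_measurable_integrable integrable_mult_indicator F) auto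
      qed
      moreover have "(LINT x:box l' u'|lebesgue. ?F x) = (LINT x:box a b|lebesgue. f x)"
        unfolding set_lebesgue_integral_def ab[symmetric]
        by (intro Bochner_Integration.integral_cong) (auto simp: indicator_def)
      ultimately show "(LINT x:box l' u'|lborel. g x) = 0" by simp
    qed
    with g(2) have "AE x in lborel. ?F x = 0" by eventually_elim simp
    then have "AE x in lebesgue. ?F x = 0" by (rule AE_completion)
    moreover have "AE x in lebesgue. x \<notin> cbox l u - box l u"
      using negligible_frontier_interval negligible_iff_null_sets by (intro AE_not_in) blast
    ultimately show ?thesis by eventually_elim (auto simp: indicator_def split: if_splits)
  qed
  obtain D where D: "countable D" "D \<subseteq> Pow \<Omega>" "\<And>X. X \<in> D \<Longrightarrow> \<exists>a b. X = cbox a b" "\<Union>D = \<Omega>"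
    using open_countable_Union_open_cbox[OF \<open>open \<Omega>\<close>] by metis
  have "AE x in lebesgue. \<forall>X\<in>D. x \<in> X \<longrightarrow> f x = 0"
    using D cbox by (subst AE_ball_countable) (auto, metis PowD subsetD)
  then have "AE x in lebesgue. x \<in> \<Omega> \<longrightarrow> f x = 0"
    by eventually_elim (use D(4) in auto)
  then show ?thesis using \<open>open \<Omega>\<close> by (simp add: AE_lebesgue_on_iff)
qed

section \<open>Test functions and uniqueness of weak gradients\<close>

lemma eq_0_outside_support: "x \<notin> closure {x. f x \<noteq> 0} \<Longrightarrow> f x = 0"
  using closure_subset[of "{x. f x \<noteq> 0}"] by auto

lemma test_function_subset:
  assumes "test_function \<Omega> \<phi>" "smooth \<psi>" "closure {x. \<psi> x \<noteq> 0} \<subseteq> closure {x. \<phi> x \<noteq> 0}"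
  shows "test_function \<Omega> \<psi>"
proof -
  have "compact (closure {x. \<phi> x \<noteq> 0} \<inter> closure {x. \<psi> x \<noteq> 0})"
    using assms(1) by (intro compact_Int_closed) (auto simp: test_function_def)
  moreover have "closure {x. \<phi> x \<noteq> 0} \<inter> closure {x. \<psi> x \<noteq> 0} = closure {x. \<psi> x \<noteq> 0}"
    using assms(3) by blast
  ultimately have "compact (closure {x. \<psi> x \<noteq> 0})" by simp
  moreover have "closure {x. \<psi> x \<noteq> 0} \<subseteq> \<Omega>"
    using assms(1,3) unfolding test_function_def by (elim conjE) (rule subset_trans)
  ultimately show ?thesis
    using assms(2) by (simp only: test_function_def simp_thms)
qed

text \<open>The complement of the support is open, so the function vanishes near each of its points
  and its derivatives vanish there too.\<close>

lemma partial_test_function: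
  assumes "test_function \<Omega> \<phi>"
  shows "test_function \<Omega> (partial i \<phi>)"
proof -
  have "{x. partial i \<phi> x \<noteq> 0} \<subseteq> closure {x. \<phi> x \<noteq> 0}"
  proof
    fix x assume "x \<in> {x. partial i \<phi> x \<noteq> 0}"
    moreover have "partial i \<phi> x = 0" if x: "x \<notin> closure {x. \<phi> x \<noteq> 0}"
    proof -
      have "(\<phi> has_derivative (\<lambda>h. 0)) (at x)"
      proof (rule has_derivative_transform_within_open)
        show "((\<lambda>x. 0) has_derivative (\<lambda>h. 0)) (at x)" by simp
        show "x \<in> - closure {x. \<phi> x \<noteq> 0}" using x by simp
        show "0 = \<phi> y" if "y \<in> - closure {x. \<phi> x \<noteq> 0}" for y
          using eq_0_outside_support[of y \<phi>] that by simp
      qed auto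
      from partial_eqI[OF this] show ?thesis .
    qed
    ultimately show "x \<in> closure {x. \<phi> x \<noteq> 0}" by auto
  qed
  then have "closure {x. partial i \<phi> x \<noteq> 0} \<subseteq> closure {x. \<phi> x \<noteq> 0}"
    by (simp add: closure_minimal)
  with assms show ?thesis
    by (intro test_function_subset[OF assms] smooth_partial) (auto simp: test_function_def)
qed

lemma L1_loc_continuous:
  assumes "continuous_on UNIV f"
  shows "L1_loc \<Omega> f"
  unfolding L1_loc_iff
proof (intro allI impI)
  fix K assume "compact K \<and> K \<subseteq> \<Omega>"
  then have "integrable lborel (\<lambda>x. indicator K x *\<^sub>R f x)"
    using assms by (intro borel_integrable_compact) (auto intro: continuous_on_subset)
  then show "set_integrable lebesgue K f"
    unfolding set_integrable_def by (simp add: integrable_completion)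
qed

lemma L1_loc_component: "L1_loc \<Omega> G \<Longrightarrow> L1_loc \<Omega> (\<lambda>x. G x $ i)"
  unfolding L1_loc_def using integrable_bounded_linear[OF bounded_linear_vec_nth] by blast

lemma L1_loc_add: "L1_loc \<Omega> f \<Longrightarrow> L1_loc \<Omega> g \<Longrightarrow> L1_loc \<Omega> (\<lambda>x. f x + g x)"
  unfolding L1_loc_def by auto

lemma L1_loc_diff: "L1_loc \<Omega> f \<Longrightarrow> L1_loc \<Omega> g \<Longrightarrow> L1_loc \<Omega> (\<lambda>x. f x - g x)"
  unfolding L1_loc_def by auto

lemma L1_loc_mult_test_function:
  fixes f :: "real^'n \<Rightarrow> real"
  assumes L1: "L1_loc \<Omega> f" and \<phi>: "test_function \<Omega> \<phi>" and \<Omega>: "\<Omega> \<in> sets lebesgue"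
  shows "integrable (lebesgue_on \<Omega>) (\<lambda>x. f x * \<phi> x)"
proof -
  define K where "K = closure {x. \<phi> x \<noteq> 0}"
  have K: "compact K" "K \<subseteq> \<Omega>"
    using \<phi> by (simp_all add: test_function_def K_def)
  have K0: "\<phi> x = 0" if "x \<notin> K" for x
    using that unfolding K_def by (rule eq_0_outside_support)
  have cont: "continuous_on UNIV \<phi>"
    using \<phi> by (auto simp: test_function_def smooth_continuous_on)
  have "bounded (\<phi> ` K)"
    by (intro compact_imp_bounded compact_continuous_image K(1) continuous_on_subset[OF cont]) auto
  then obtain B where B: "\<And>x. x \<in> K \<Longrightarrow> norm (\<phi> x) \<le> B" by (auto simp: bounded_iff)
  have fK: "integrable lebesgue (\<lambda>x. indicator K x *\<^sub>R f x)"
    using L1 K by (auto simp: L1_loc_iff set_integrable_def)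
  have "integrable lebesgue (\<lambda>x. (indicator K x *\<^sub>R f x) * \<phi> x)"
  proof (rule Bochner_Integration.integrable_bound)
    show "integrable lebesgue (\<lambda>x. (indicator K x *\<^sub>R f x) * B)" using fK by simp
    show "(\<lambda>x. (indicator K x *\<^sub>R f x) * \<phi> x) \<in> borel_measurable lebesgue"
      using cont
      by (intro borel_measurable_times borel_measurable_integrable[OF fK] measurable_completion)
         (auto intro: borel_measurable_continuous_onI)
    show "AE x in lebesgue. norm ((indicator K x *\<^sub>R f x) * \<phi> x) \<le> norm ((indicator K x *\<^sub>R f x) * B)"
    proof (rule AE_I2)
      fix x
      show "norm ((indicator K x *\<^sub>R f x) * \<phi> x) \<le> norm ((indicator K x *\<^sub>R f x) * B)"
        using B[of x] by (cases "x \<in> K") (auto simp: abs_mult intro!: mult_left_mono)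
    qed
  qed
  also have "(\<lambda>x. (indicator K x *\<^sub>R f x) * \<phi> x) = (\<lambda>x. indicator \<Omega> x *\<^sub>R (f x * \<phi> x))"
    using K(2) K0 by (force simp: indicator_def)
  finally show ?thesis
    using \<Omega> by (subst integrable_restrict_space) auto
qed

lemma test_functionD: "test_function \<Omega> \<phi> \<Longrightarrow> smooth \<phi>"
  by (simp add: test_function_def)

text \<open>Two weak gradients give the same pairing with every test function, so the fundamental
  lemma applies to each component of their difference. This frees later arguments from the choice
  made in \<open>wgrad\<close>.\<close>

lemma weak_gradient_unique:
  fixes \<Omega> :: "(real^'n) set"
  assumes "open \<Omega>" "has_weak_gradient \<Omega> f G" "has_weak_gradient \<Omega> f G'"
  shows "AE x in lebesgue_on \<Omega>. G x = G' x"
proof -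
  have "AE x in lebesgue_on \<Omega>. G x $ i - G' x $ i = 0" for i
  proof (rule fundamental_lemma[OF _ \<open>open \<Omega>\<close>])
    have L1: "L1_loc \<Omega> (\<lambda>x. G x $ i)" "L1_loc \<Omega> (\<lambda>x. G' x $ i)"
      using assms(2,3) by (auto simp: has_weak_gradient_def L1_loc_component)
    then show "L1_loc \<Omega> (\<lambda>x. G x $ i - G' x $ i)" by (rule L1_loc_diff)
    fix \<phi> assume \<phi>: "test_function \<Omega> \<phi>"
    have "(LINT x|lebesgue_on \<Omega>. f x * partial i \<phi> x) = - (LINT x|lebesgue_on \<Omega>. G x $ i * \<phi> x)"
      "(LINT x|lebesgue_on \<Omega>. f x * partial i \<phi> x) = - (LINT x|lebesgue_on \<Omega>. G' x $ i * \<phi> x)"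
      using assms(2,3) \<phi> unfolding has_weak_gradient_def by blast+
    then have "(LINT x|lebesgue_on \<Omega>. G x $ i * \<phi> x) = (LINT x|lebesgue_on \<Omega>. G' x $ i * \<phi> x)"
      by simp
    then show "(LINT x|lebesgue_on \<Omega>. (G x $ i - G' x $ i) * \<phi> x) = 0"
      using L1_loc_mult_test_function[OF L1(1) \<phi>] L1_loc_mult_test_function[OF L1(2) \<phi>] \<open>open \<Omega>\<close>
      by (simp add: left_diff_distrib)
  qed
  then have "AE x in lebesgue_on \<Omega>. \<forall>i\<in>UNIV. G x $ i - G' x $ i = 0"
    by (intro AE_finite_allI) auto
  then show ?thesis by eventually_elim (simp add: vec_eq_iff)
qed

lemma has_weak_gradient_add:
  assumes \<Omega>: "\<Omega> \<in> sets lebesgue" and f: "has_weak_gradient \<Omega> f F" and g: "has_weak_gradient \<Omega> g G"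
  shows "has_weak_gradient \<Omega> (\<lambda>x. f x + g x) (\<lambda>x. F x + G x)"
  unfolding has_weak_gradient_def
proof (intro conjI allI impI)
  have L1: "L1_loc \<Omega> f" "L1_loc \<Omega> g" "L1_loc \<Omega> F" "L1_loc \<Omega> G"
    using f g by (auto simp: has_weak_gradient_def)
  then show "L1_loc \<Omega> (\<lambda>x. f x + g x)" "L1_loc \<Omega> (\<lambda>x. F x + G x)"
    by (auto intro: L1_loc_add)
  fix \<phi> i assume \<phi>: "test_function \<Omega> \<phi>"
  note int = L1_loc_mult_test_function[OF _ _ \<Omega>]
  show "(LINT x|lebesgue_on \<Omega>. (f x + g x) * partial i \<phi> x) =
      - (LINT x|lebesgue_on \<Omega>. (F x + G x) $ i * \<phi> x)"
    using f g \<phi> unfolding has_weak_gradient_def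
    by (simp add: distrib_right int L1 partial_test_function L1_loc_component)
qed

section \<open>Classical gradients are weak gradients\<close>

lemma smooth_has_derivative:
  assumes "smooth f"
  shows "(f has_derivative (\<lambda>h. grad f x \<bullet> h)) (at x)"
proof -
  have d: "(f has_derivative frechet_derivative f (at x)) (at x)"
    using smooth_differentiable[OF assms] by (simp add: frechet_derivative_works)
  then interpret bounded_linear "frechet_derivative f (at x)" by (rule has_derivative_bounded_linear)
  have "frechet_derivative f (at x) h = grad f x \<bullet> h" for h
  proof -
    have "frechet_derivative f (at x) h = frechet_derivative f (at x) (\<Sum>i\<in>UNIV. h $ i *\<^sub>R axis i 1)"
      by (metis basis_expansion scalar_mult_eq_scaleR)
    then show ?thesis
      by (simp add: sum scale inner_vec_def grad_def partial_def mult.commute)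
  qed
  then have "frechet_derivative f (at x) = (\<lambda>h. grad f x \<bullet> h)" by blast
  then show ?thesis using d by simp
qed

lemma DERIV_smooth_line:
  assumes "smooth f"
  shows "((\<lambda>t. f (x + t *\<^sub>R axis i 1)) has_real_derivative partial i f (x + t *\<^sub>R axis i 1)) (at t)"
proof -
  have "((\<lambda>t. x + t *\<^sub>R axis i 1) has_derivative (\<lambda>t. t *\<^sub>R axis i 1)) (at t)"
    by (auto intro!: derivative_eq_intros)
  from has_derivative_compose[OF this smooth_has_derivative[OF assms]]
  show ?thesis
    by (simp add: has_field_derivative_def inner_axis grad_def mult_commute_abs)
qed

text \<open>Translation invariance makes the integrals of the difference quotients vanish.\<close>

lemma integral_partial_test_function:
  assumes "test_function UNIV u"
  shows "(LINT x|lborel. partial i u x) = 0"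
proof -
  define K where "K = closure {x. u x \<noteq> 0}"
  have K: "compact K"
    using assms by (simp add: test_function_def K_def)
  have K0: "u x = 0" if "x \<notin> K" for x
    using that unfolding K_def by (rule eq_0_outside_support)
  have sm: "smooth u" using assms by (rule test_functionD)
  define h where "h n = inverse (real (Suc n))" for n
  have h: "h \<longlonglongrightarrow> 0" "\<And>n. h n > 0" "\<And>n. h n \<le> 1"
    unfolding h_def using LIMSEQ_inverse_real_of_nat by (auto simp: inverse_eq_divide)
  \<comment> \<open>A compact set, the same for all n, that contains the supports of all translates
    of \<open>u\<close> by -h with 0 <= h <= 1. Every difference quotient vanishes outside it and is
    bounded by \<open>B\<close> on it by the mean value theorem, which yields a dominating
    function.\<close>
  define K' where "K' = (\<Union>t\<in>{-1..0}. (\<lambda>x. t *\<^sub>R axis i 1 + x) ` K)"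
  have K'_eq: "K' = (\<lambda>(t, x). t *\<^sub>R axis i 1 + x) ` ({-1..0} \<times> K)"
    unfolding K'_def by auto
  have "compact K'"
    unfolding K'_eq by (intro compact_continuous_image compact_Times K)
      (auto intro!: continuous_intros simp: case_prod_unfold)
  obtain B where B: "\<And>x. norm (partial i u x) \<le> B"
  proof -
    note t = partial_test_function[OF assms, of i]
    define L where "L = closure {x. partial i u x \<noteq> 0}"
    have "compact L" using t by (simp add: test_function_def L_def)
    have L0: "partial i u x = 0" if "x \<notin> L" for x
      using that unfolding L_def by (rule eq_0_outside_support)
    from \<open>compact L\<close> have "bounded (partial i u ` L)"
      by (intro compact_imp_bounded compact_continuous_image smooth_continuous_on smooth_partial sm)
    then obtain B where "\<And>x. x \<in> L \<Longrightarrow> norm (partial i u x) \<le> B" by (auto simp: bounded_iff)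
    then have "norm (partial i u x) \<le> max B 0" for x
      using L0[of x] by (cases "x \<in> L") (auto intro: max.coboundedI1)
    then show ?thesis by (rule that)
  qed
  let ?q = "\<lambda>n x. (u (x + h n *\<^sub>R axis i 1) - u x) / h n"
  have int: "integrable lborel u"
  proof -
    have "integrable lborel (\<lambda>x. indicator K x *\<^sub>R u x)"
      using K smooth_continuous_on[OF sm] by (rule borel_integrable_compact)
    also have "(\<lambda>x. indicator K x *\<^sub>R u x) = u" using K0 by (auto simp: indicator_def fun_eq_iff)
    finally show ?thesis .
  qed
  have "(\<lambda>n. LINT x|lborel. ?q n x) \<longlonglongrightarrow> (LINT x|lborel. partial i u x)"
  proof (rule integral_dominated_convergence)
    show "integrable lborel (\<lambda>x. indicator K' x *\<^sub>R B)"
      using \<open>compact K'\<close> by (rule borel_integrable_compact) auto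
    show "partial i u \<in> borel_measurable lborel"
      using smooth_continuous_on[OF smooth_partial[OF sm]] by (auto intro: borel_measurable_continuous_onI)
    have "continuous_on UNIV u" using sm by (rule smooth_continuous_on)
    then show "?q n \<in> borel_measurable lborel" for n
      by (auto intro!: borel_measurable_continuous_onI continuous_intros
          continuous_on_compose2[of UNIV u] simp: less_imp_neq[OF h(2), symmetric])
    show "AE x in lborel. (\<lambda>n. ?q n x) \<longlonglongrightarrow> partial i u x"
    proof (rule AE_I2)
      fix x
      have "((\<lambda>t. (u (x + t *\<^sub>R axis i 1) - u x) / t) \<longlongrightarrow> partial i u x) (at 0)"
        using DERIV_smooth_line[OF sm, of x i 0] by (simp add: DERIV_def)
      moreover have "filterlim h (at 0) sequentially"
        using h by (auto simp: filterlim_at less_imp_neq[OF h(2), symmetric])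
      ultimately show "(\<lambda>n. ?q n x) \<longlonglongrightarrow> partial i u x"
        by (rule filterlim_compose)
    qed
    show "AE x in lborel. norm (?q n x) \<le> indicator K' x *\<^sub>R B" for n
    proof (rule AE_I2)
      fix x
      show "norm (?q n x) \<le> indicator K' x *\<^sub>R B"
      proof (cases "x \<in> K'")
        case True
        obtain z where "u (x + h n *\<^sub>R axis i 1) - u (x + 0 *\<^sub>R axis i 1)
            = (h n - 0) * partial i u (x + z *\<^sub>R axis i 1)"
          using MVT2[of 0 "h n" "\<lambda>t. u (x + t *\<^sub>R axis i 1)", OF h(2) DERIV_smooth_line[OF sm]] by blast
        then have "?q n x = partial i u (x + z *\<^sub>R axis i 1)" using h(2)[of n] by simp
        then show ?thesis using B True by simp
      next
        case False
        have "x \<notin> K"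
          using False by (auto simp: K'_def dest!: bspec[of _ _ 0])
        moreover have "x + h n *\<^sub>R axis i 1 \<notin> K"
        proof
          assume "x + h n *\<^sub>R axis i 1 \<in> K"
          then have "(- h n) *\<^sub>R axis i 1 + (x + h n *\<^sub>R axis i 1) \<in> K'"
            using h(2,3)[of n] unfolding K'_eq by (intro image_eqI[of _ _ "(- h n, _)"]) (auto simp: less_imp_le)
          then show False using False by simp
        qed
        ultimately show ?thesis using K0 False by simp
      qed
    qed
  qed
  moreover have "(LINT x|lborel. ?q n x) = 0" for n
  proof -
    have d: "lborel = distr lborel borel ((+) (h n *\<^sub>R axis i 1))"
      by (rule lborel_distr_plus[symmetric])
    have m: "u \<in> borel_measurable borel"
      using sm by (auto intro: borel_measurable_continuous_onI smooth_continuous_on)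
    have "integrable lborel (\<lambda>x. u (h n *\<^sub>R axis i 1 + x))"
      using int m by (subst (asm) d, subst (asm) integrable_distr_eq) auto
    moreover have "(LINT x|lborel. u x) = (LINT x|lborel. u (h n *\<^sub>R axis i 1 + x))"
      using m by (subst d, subst integral_distr) auto
    ultimately show ?thesis using int by (simp add: add.commute[of _ "h n *\<^sub>R axis i 1"])
  qed
  ultimately show ?thesis by (simp only: LIMSEQ_const_iff)
qed

lemma test_function_mult:
  assumes "smooth f" "test_function \<Omega> \<phi>"
  shows "test_function \<Omega> (\<lambda>x. f x * \<phi> x)"
proof -
  have "closure {x. f x * \<phi> x \<noteq> 0} \<subseteq> closure {x. \<phi> x \<noteq> 0}"
    by (intro closure_mono) auto
  with assms show ?thesis
    by (intro test_function_subset[OF assms(2)] smooth_mult) (auto simp: test_function_def)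
qed

lemma continuous_on_grad: "smooth f \<Longrightarrow> continuous_on S (grad f)"
  unfolding grad_def by (intro continuous_on_vec_lambda smooth_continuous_on smooth_partial)

text \<open>The product of \<open>f\<close> with a test function is again a test function, so its
  partial derivative integrates to 0. The product rule turns this into the defining
  identity.\<close>

lemma smooth_has_weak_gradient:
  fixes \<Omega> :: "(real^'n) set"
  assumes f: "smooth f" and "open \<Omega>"
  shows "has_weak_gradient \<Omega> f (grad f)"
  unfolding has_weak_gradient_def
proof (intro conjI allI impI)
  show L1: "L1_loc \<Omega> f" "L1_loc \<Omega> (grad f)"
    using f by (auto intro: L1_loc_continuous smooth_continuous_on continuous_on_grad)
  fix \<phi> i assume \<phi>: "test_function \<Omega> \<phi>"
  let ?u = "\<lambda>x. f x * \<phi> x"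
  have u: "test_function \<Omega> ?u" using f \<phi> by (rule test_function_mult)
  then have u': "test_function UNIV ?u" by (auto simp: test_function_def)
  have \<Omega>: "\<Omega> \<in> sets lebesgue" using \<open>open \<Omega>\<close> by auto
  have p: "partial i ?u x = f x * partial i \<phi> x + grad f x $ i * \<phi> x" for x
    using f test_functionD[OF \<phi>] by (simp add: partial_mult smooth_differentiable grad_def)
  have "0 = (LINT x|lborel. partial i ?u x)"
    using integral_partial_test_function[OF u'] by simp
  also have "\<dots> = (LINT x|lebesgue. partial i ?u x)"
    using smooth_continuous_on[OF smooth_partial[OF test_functionD[OF u]]]
    by (intro integral_completion[symmetric]) (auto intro: borel_measurable_continuous_onI)
  also have "\<dots> = (LINT x|lebesgue. indicator \<Omega> x *\<^sub>R partial i ?u x)"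
  proof (rule Bochner_Integration.integral_cong)
    have s: "closure {x. partial i ?u x \<noteq> 0} \<subseteq> \<Omega>"
      using partial_test_function[OF u, of i] by (simp only: test_function_def)
    have "partial i ?u x = 0" if "x \<notin> \<Omega>" for x
      using contra_subsetD[OF s that] by (rule eq_0_outside_support)
    then show "partial i ?u x = indicator \<Omega> x *\<^sub>R partial i ?u x" for x
      by (cases "x \<in> \<Omega>") auto
  qed simp
  also have "\<dots> = (LINT x|lebesgue_on \<Omega>. partial i ?u x)"
    using \<Omega> by (subst integral_restrict_space) auto
  also have "\<dots> = (LINT x|lebesgue_on \<Omega>. f x * partial i \<phi> x) + (LINT x|lebesgue_on \<Omega>. grad f x $ i * \<phi> x)"
    unfolding p
    by (intro Bochner_Integration.integral_add L1_loc_mult_test_function[OF _ _ \<Omega>] L1 \<phi>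
        partial_test_function L1_loc_component)
  finally show "(LINT x|lebesgue_on \<Omega>. f x * partial i \<phi> x) = - (LINT x|lebesgue_on \<Omega>. grad f x $ i * \<phi> x)"
    by simp
qed

lemma wgrad_AE_eq:
  fixes \<Omega> :: "(real^'n) set"
  assumes "open \<Omega>" "has_weak_gradient \<Omega> f G"
  shows "AE x in lebesgue_on \<Omega>. wgrad \<Omega> f x = G x"
  unfolding wgrad_def
  by (rule weak_gradient_unique[OF assms(1) someI[of "has_weak_gradient \<Omega> f", OF assms(2)] assms(2)])

section \<open>Integration over rectangles\<close>

lemma vector_2_eta: "vector [x $ 1, x $ 2] = (x :: real^2)"
  by (simp add: vec_eq_iff forall_2)

lemma ex_2: "(\<exists>i::2. P i) \<longleftrightarrow> P 1 \<or> P 2"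
  by (metis exhaust_2)

lemma vector_2_eq: "(vector [s, t] :: real^2) = (\<chi> j. if j = 1 then s else t)"
  by (simp add: vec_eq_iff forall_2)

lemma mem_cbox_2: "x \<in> cbox l u \<longleftrightarrow> l $ 1 \<le> x $ 1 \<and> x $ 1 \<le> u $ 1 \<and> l $ 2 \<le> x $ 2 \<and> x $ 2 \<le> u $ 2"
  for x :: "real^2"
  by (auto simp: mem_box_cart forall_2)

lemma continuous_on_vector_2 [continuous_intros]:
  fixes f g :: "'a::topological_space \<Rightarrow> real"
  assumes "continuous_on S f" "continuous_on S g"
  shows "continuous_on S (\<lambda>x. vector [f x, g x] :: real^2)"
  unfolding vector_2_eq proof (rule continuous_on_vec_lambda)
  show "continuous_on S (\<lambda>x. if j = 1 then f x else g x)" for j :: 2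
    using assms by (cases "j = 1") auto
qed

lemma measure_cbox_2:
  fixes l u :: "real^2"
  assumes "l $ 1 \<le> u $ 1" "l $ 2 \<le> u $ 2"
  shows "measure lborel (cbox l u) = (u $ 1 - l $ 1) * (u $ 2 - l $ 2)"
proof -
  have "cbox l u \<noteq> {}" using assms by (auto simp: interval_eq_empty_cart ex_2)
  then show ?thesis by (simp add: content_cbox_cart UNIV_2)
qed

text \<open>Fubini for iterated integrals is available on pairs. It is transported along the
  bijection between pairs and vectors, which maps boxes to boxes of the same area; this is the
  factor 1 in \<open>has_integral_twiddle\<close>.\<close>

lemma integral_cbox_2:
  fixes F :: "real^2 \<Rightarrow> real"
  assumes F: "continuous_on (cbox l u) F"
  shows "integral (cbox l u) F = integral {l $ 1..u $ 1} (\<lambda>s. integral {l $ 2..u $ 2} (\<lambda>t. F (vector [s, t])))"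
proof -
  let ?v = "\<lambda>p :: real \<times> real. vector [fst p, snd p] :: real^2"
  let ?w = "\<lambda>x :: real^2. (x $ 1, x $ 2)"
  have v_img: "?v ` cbox a b = cbox (?v a) (?v b)" for a b
  proof (intro equalityI subsetI)
    fix x assume "x \<in> cbox (?v a) (?v b)"
    then show "x \<in> ?v ` cbox a b"
      by (intro image_eqI[of _ _ "?w x"]) (auto simp: mem_cbox_2 vector_2_eta cbox_prod)
  qed (auto simp: mem_cbox_2 cbox_prod)
  have w_img: "?w ` cbox a b = cbox (?w a) (?w b)" for a b
  proof (intro equalityI subsetI)
    fix p assume "p \<in> cbox (?w a) (?w b)"
    then show "p \<in> ?w ` cbox a b"
      by (intro image_eqI[of _ _ "?v p"]) (auto simp: mem_cbox_2 cbox_prod)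
  qed (auto simp: mem_cbox_2 cbox_prod)
  have cont: "continuous_on (cbox (?w l) (?w u)) (\<lambda>p. F (?v p))"
    by (rule continuous_on_compose2[OF F]) (auto intro!: continuous_intros simp: mem_cbox_2 cbox_prod)
  have "((\<lambda>x. F (?v (?w x))) has_integral (1 / 1) *\<^sub>R integral (cbox (?w l) (?w u)) (\<lambda>p. F (?v p)))
      (?v ` cbox (?w l) (?w u))"
  proof (rule has_integral_twiddle)
    show "((\<lambda>p. F (?v p)) has_integral integral (cbox (?w l) (?w u)) (\<lambda>p. F (?v p))) (cbox (?w l) (?w u))"
      by (intro integrable_integral integrable_continuous cont)
    show "measure lborel (?w ` cbox a b) = 1 * measure lborel (cbox a b)" for a b
    proof (cases "cbox a b = {}")
      case False
      then have "a $ 1 \<le> b $ 1" "a $ 2 \<le> b $ 2" by (auto simp: interval_eq_empty_cart ex_2 not_less)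
      then show ?thesis unfolding w_img by (simp add: content_Pair measure_cbox_2)
    qed simp
  qed (auto simp: vector_2_eta v_img w_img intro!: continuous_intros)
  then have "(F has_integral integral (cbox (?w l) (?w u)) (\<lambda>p. F (?v p))) (cbox l u)"
    by (simp add: vector_2_eta v_img)
  then have "integral (cbox l u) F = integral (cbox (?w l) (?w u)) (\<lambda>p. F (?v p))"
    by (rule integral_unique)
  also have "\<dots> = integral {l $ 1..u $ 1} (\<lambda>s. integral {l $ 2..u $ 2} (\<lambda>t. F (vector [s, t])))"
    using integral_prod_continuous[OF cont] by (simp add: box_real)
  finally show ?thesis .
qed

lemma continuous_on_slices:
  fixes F :: "real^2 \<Rightarrow> real"
  assumes F: "continuous_on (cbox l u) F"
  shows "continuous_on (cbox (l $ 1, l $ 2) (u $ 1, u $ 2)) (\<lambda>(s, t). F (vector [s, t]))"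
    and "continuous_on (cbox (l $ 2, l $ 1) (u $ 2, u $ 1)) (\<lambda>(t, s). F (vector [s, t]))"
  unfolding case_prod_unfold
  by (auto intro!: continuous_on_compose2[OF F] continuous_intros simp: mem_cbox_2 cbox_prod)

lemma integral_cbox_2_swap:
  fixes F :: "real^2 \<Rightarrow> real"
  assumes F: "continuous_on (cbox l u) F"
  shows "integral (cbox l u) F = integral {l $ 2..u $ 2} (\<lambda>t. integral {l $ 1..u $ 1} (\<lambda>s. F (vector [s, t])))"
  using integral_cbox_2[OF F] integral_swap_continuous[OF continuous_on_slices(1)[OF F]]
  by (simp add: box_real)

lemma slice_integrable:
  fixes F :: "real^2 \<Rightarrow> real"
  assumes F: "continuous_on (cbox l u) F"
  shows "(\<lambda>t. integral {l $ 1..u $ 1} (\<lambda>s. F (vector [s, t]))) integrable_on {l $ 2..u $ 2}"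
  using integral_integrable_2dim[OF continuous_on_slices(2)[OF F]] by (simp add: box_real)

lemma vector_2_line:
  "vector [s, t] = vector [0, t] + s *\<^sub>R (axis 1 1 :: real^2)"
  "vector [s, t] = vector [s, 0] + t *\<^sub>R (axis 2 1 :: real^2)"
  by (simp_all add: vec_eq_iff forall_2 axis_def)

lemma DERIV_slice_1: "smooth (f :: real^2 \<Rightarrow> real) \<Longrightarrow>
    ((\<lambda>s. f (vector [s, t])) has_real_derivative partial 1 f (vector [s, t])) (at s)"
  using DERIV_smooth_line[of f "vector [0, t]" 1 s] by (simp add: vector_2_line(1)[symmetric])

lemma DERIV_slice_2: "smooth (f :: real^2 \<Rightarrow> real) \<Longrightarrow>
    ((\<lambda>t. f (vector [s, t])) has_real_derivative partial 2 f (vector [s, t])) (at t)"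
  using DERIV_smooth_line[of f "vector [s, 0]" 2 t] by (simp add: vector_2_line(2)[symmetric])

lemma integral_slice_1:
  "smooth (f :: real^2 \<Rightarrow> real) \<Longrightarrow> a \<le> b \<Longrightarrow>
    ((\<lambda>s. partial 1 f (vector [s, t])) has_integral f (vector [b, t]) - f (vector [a, t])) {a..b}"
  using DERIV_slice_1[of f t]
  by (intro fundamental_theorem_of_calculus)
     (auto simp: has_real_derivative_iff_has_vector_derivative intro: has_vector_derivative_at_within)

lemma integral_slice_2:
  "smooth (f :: real^2 \<Rightarrow> real) \<Longrightarrow> a \<le> b \<Longrightarrow>
    ((\<lambda>t. partial 2 f (vector [s, t])) has_integral f (vector [s, b]) - f (vector [s, a])) {a..b}"
  using DERIV_slice_2[of f s]
  by (intro fundamental_theorem_of_calculus)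
     (auto simp: has_real_derivative_iff_has_vector_derivative intro: has_vector_derivative_at_within)

lemma integral_partial_1:
  fixes f :: "real^2 \<Rightarrow> real"
  assumes "smooth f" "l $ 1 \<le> u $ 1"
  shows "integral (cbox l u) (partial 1 f) =
    integral {l $ 2..u $ 2} (\<lambda>t. f (vector [u $ 1, t]) - f (vector [l $ 1, t]))"
  using integral_unique[OF integral_slice_1[OF assms]]
  by (simp add: integral_cbox_2_swap smooth_continuous_on smooth_partial assms)

lemma integral_partial_2:
  fixes f :: "real^2 \<Rightarrow> real"
  assumes "smooth f" "l $ 2 \<le> u $ 2"
  shows "integral (cbox l u) (partial 2 f) =
    integral {l $ 1..u $ 1} (\<lambda>s. f (vector [s, u $ 2]) - f (vector [s, l $ 2]))"
  using integral_unique[OF integral_slice_2[OF assms]]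
  by (simp add: integral_cbox_2 smooth_continuous_on smooth_partial assms)

section \<open>Estimates for smooth functions on a rectangle\<close>

lemma integral_abs_le:
  fixes f :: "'a::euclidean_space \<Rightarrow> real"
  shows "f integrable_on S \<Longrightarrow> g integrable_on S \<Longrightarrow> (\<And>x. x \<in> S \<Longrightarrow> \<bar>f x\<bar> \<le> g x) \<Longrightarrow>
    \<bar>integral S f\<bar> \<le> integral S g"
  using Henstock_Kurzweil_Integration.integral_norm_bound_integral[of f S g] by simp

text \<open>Along each horizontal line the value of \<open>f\<close> differs from the value at first
  coordinate \<open>a\<close> by at most the integral of |partial 1 f| over that line. Integrating
  in the first variable costs a factor equal to the width.\<close>

lemma integral_abs_le_side:
  fixes f :: "real^2 \<Rightarrow> real"
  assumes f: "smooth f" and lu: "l $ 1 \<le> a" "a \<le> u $ 1"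
  shows "integral (cbox l u) (\<lambda>x. \<bar>f x\<bar>) \<le>
    (u $ 1 - l $ 1) * (integral {l $ 2..u $ 2} (\<lambda>t. \<bar>f (vector [a, t])\<bar>)
      + integral (cbox l u) (\<lambda>x. \<bar>partial 1 f x\<bar>))"
proof -
  note cf = smooth_continuous_on[OF f] smooth_continuous_on[OF smooth_partial[OF f]]
  let ?D = "\<lambda>t. integral {l $ 1..u $ 1} (\<lambda>s. \<bar>partial 1 f (vector [s, t])\<bar>)"
  have slice: "continuous_on A (\<lambda>s. g (vector [s, t]))" "continuous_on A (\<lambda>t. g (vector [s, t]))"
    if "continuous_on UNIV g" for g :: "real^2 \<Rightarrow> real" and A s t
    by (auto intro!: continuous_on_compose2[OF that] continuous_intros)
  have int: "(\<lambda>s. \<bar>g (vector [s, t])\<bar>) integrable_on {a..b}" "(\<lambda>t. \<bar>g (vector [s, t])\<bar>) integrable_on {a..b}"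
    if "continuous_on UNIV g" for g :: "real^2 \<Rightarrow> real" and a b s t
    by (auto intro!: integrable_continuous_real continuous_intros slice that)
  have pt: "\<bar>f (vector [s, t])\<bar> \<le> \<bar>f (vector [a, t])\<bar> + ?D t" if "s \<in> {l $ 1..u $ 1}" for s t
  proof -
    have key: "\<bar>f (vector [q, t]) - f (vector [p, t])\<bar> \<le> ?D t"
      if "p \<le> q" "l $ 1 \<le> p" "q \<le> u $ 1" for p q
    proof -
      have "\<bar>f (vector [q, t]) - f (vector [p, t])\<bar> = \<bar>integral {p..q} (\<lambda>s. partial 1 f (vector [s, t]))\<bar>"
        using integral_unique[OF integral_slice_1[OF f that(1)]] by simp
      also have "\<dots> \<le> integral {p..q} (\<lambda>s. \<bar>partial 1 f (vector [s, t])\<bar>)"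
      proof (rule integral_abs_le)
        show "(\<lambda>s. partial 1 f (vector [s, t])) integrable_on {p..q}"
          using integral_slice_1[OF f that(1)] by blast
      qed (auto intro: int cf)
      also have "\<dots> \<le> ?D t"
        using that by (intro integral_subset_le int cf) auto
      finally show ?thesis .
    qed
    show ?thesis
      using key[of s a] key[of a s] that lu by (cases "s \<le> a") auto
  qed
  have c1: "continuous_on (cbox l u) (\<lambda>x. \<bar>f x\<bar>)" "continuous_on (cbox l u) (\<lambda>x. \<bar>partial 1 f x\<bar>)"
    by (intro continuous_intros cf)+
  have "integral (cbox l u) (\<lambda>x. \<bar>f x\<bar>) =
      integral {l $ 2..u $ 2} (\<lambda>t. integral {l $ 1..u $ 1} (\<lambda>s. \<bar>f (vector [s, t])\<bar>))"
    by (rule integral_cbox_2_swap[OF c1(1)])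
  also have "\<dots> \<le> integral {l $ 2..u $ 2} (\<lambda>t. (u $ 1 - l $ 1) * (\<bar>f (vector [a, t])\<bar> + ?D t))"
  proof (rule integral_le)
    show "(\<lambda>t. integral {l $ 1..u $ 1} (\<lambda>s. \<bar>f (vector [s, t])\<bar>)) integrable_on {l $ 2..u $ 2}"
      by (rule slice_integrable[OF c1(1)])
    show "(\<lambda>t. (u $ 1 - l $ 1) * (\<bar>f (vector [a, t])\<bar> + ?D t)) integrable_on {l $ 2..u $ 2}"
      by (intro integrable_on_mult_right integrable_add int cf slice_integrable[OF c1(2)])
    fix t
    have "integral {l $ 1..u $ 1} (\<lambda>s. \<bar>f (vector [s, t])\<bar>)
        \<le> integral {l $ 1..u $ 1} (\<lambda>s. \<bar>f (vector [a, t])\<bar> + ?D t)"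
      by (intro integral_le int cf pt) auto
    then show "integral {l $ 1..u $ 1} (\<lambda>s. \<bar>f (vector [s, t])\<bar>)
        \<le> (u $ 1 - l $ 1) * (\<bar>f (vector [a, t])\<bar> + ?D t)"
      using lu by simp
  qed
  also have "\<dots> = (u $ 1 - l $ 1) * (integral {l $ 2..u $ 2} (\<lambda>t. \<bar>f (vector [a, t])\<bar>)
      + integral {l $ 2..u $ 2} ?D)"
    by (simp add: integral_add int cf slice_integrable[OF c1(2)])
  also have "integral {l $ 2..u $ 2} ?D = integral (cbox l u) (\<lambda>x. \<bar>partial 1 f x\<bar>)"
    by (rule integral_cbox_2_swap[OF c1(2), symmetric])
  finally show ?thesis .
qed

lemma integral_parabola:
  "(l::real) \<le> u \<Longrightarrow> integral {l..u} (\<lambda>t. (t - l) * (u - t)) = (u - l) ^ 3 / 6"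
proof -
  assume "l \<le> u"
  let ?p = "\<lambda>t. (l + u) * t ^ 2 / 2 - t ^ 3 / 3 - l * u * t"
  have "((\<lambda>t. (t - l) * (u - t)) has_integral ?p u - ?p l) {l..u}"
  proof (rule fundamental_theorem_of_calculus[OF \<open>l \<le> u\<close>])
    fix t
    have "(?p has_real_derivative (t - l) * (u - t)) (at t within {l..u})"
      by (auto intro!: derivative_eq_intros simp: field_simps power2_eq_square)
    then show "(?p has_vector_derivative (t - l) * (u - t)) (at t within {l..u})"
      by (simp add: has_real_derivative_iff_has_vector_derivative)
  qed
  moreover have "?p u - ?p l = (u - l) ^ 3 / 6"
    by (simp add: field_simps power2_eq_square power3_eq_cube)
  ultimately show ?thesis by (metis integral_unique)
qed

text \<open>Integration of \<open>partial 2 f\<close> by parts against a parabola in the second variable. On the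
  right-hand side \<open>|L $ 1|\<close> comes with \<open>d\<^sup>2\<close>, so its contribution disappears for thin boxes.\<close>

lemma vertical_derivative_bound:
  fixes f :: "real^2 \<Rightarrow> real" and L :: "real^2"
  assumes f: "smooth f" and lu: "l $ 1 \<le> a" "a \<le> u $ 1" "l $ 2 \<le> u $ 2"
  defines "d \<equiv> u $ 1 - l $ 1" and "e \<equiv> u $ 2 - l $ 2"
    and "w \<equiv> integral (cbox l u) (\<lambda>x. norm (grad f x - L))"
    and "b \<equiv> integral {l $ 2..u $ 2} (\<lambda>t. \<bar>f (vector [a, t])\<bar>)"
  shows "\<bar>L $ 2\<bar> * (d * e ^ 3 / 6) \<le> e ^ 2 * w + e * (d * (b + (\<bar>L $ 1\<bar> * (d * e) + w)))"
proof -
  let ?R = "cbox l u"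
  \<comment> \<open>The weight vanishes on both horizontal sides, so integrating by parts leaves no
    boundary term, not even on the free side. Its integral is d e^3 / 6; in absolute value it is at
    most e^2 and its derivative at most e, which gives the powers of e in the claim.\<close>
  let ?c = "\<lambda>x::real^2. (x $ 2 - l $ 2) * (u $ 2 - x $ 2)"
  have de: "d \<ge> 0" "e \<ge> 0" using lu by (auto simp: d_def e_def)
  have sc: "smooth ?c"
  proof -
    have "smooth (\<lambda>x::real^2. (x $ 2 + - l $ 2) * (u $ 2 + - 1 * x $ 2))"
      by (intro smooth_mult smooth_add smooth_component smooth_const)
    then show ?thesis by simp
  qed
  have pc: "partial 2 ?c x = l $ 2 + u $ 2 - 2 * x $ 2" for x
  proof -
    have "((\<lambda>t. (t - l $ 2) * (u $ 2 - t)) has_real_derivative l $ 2 + u $ 2 - 2 * t) (at t)" for t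
      by (auto intro!: derivative_eq_intros)
    from partial_eqI[OF has_derivative_comp_component[OF this, where i = 2], of 2 x]
    show ?thesis by (simp add: axis_def)
  qed
  note cf = smooth_continuous_on[OF f] smooth_continuous_on[OF smooth_partial[OF f]] continuous_on_grad[OF f]
  have cc: "continuous_on A ?c" for A by (intro continuous_intros)
  have int: "g integrable_on ?R" if "continuous_on ?R g" for g :: "real^2 \<Rightarrow> real"
    using that by (rule integrable_continuous)
  have p: "partial 2 (\<lambda>x. f x * ?c x) = (\<lambda>x. f x * (l $ 2 + u $ 2 - 2 * x $ 2) + partial 2 f x * ?c x)"
    by (rule ext, subst partial_mult[OF smooth_differentiable[OF f] smooth_differentiable[OF sc]])
       (simp only: pc)
  have "integral ?R (partial 2 (\<lambda>x. f x * ?c x)) = 0"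
    by (subst integral_partial_2[OF smooth_mult[OF f sc] lu(3)]) simp
  then have parts: "integral ?R (\<lambda>x. partial 2 f x * ?c x)
      = - integral ?R (\<lambda>x. f x * (l $ 2 + u $ 2 - 2 * x $ 2))"
    unfolding p by (subst (asm) integral_add) (auto intro!: int continuous_intros cf)
  have "integral ?R ?c = d * e ^ 3 / 6"
    using lu by (simp add: integral_cbox_2[OF cc] integral_parabola d_def e_def)
  then have "L $ 2 * (d * e ^ 3 / 6) = integral ?R (\<lambda>x. L $ 2 * ?c x)" by simp
  also have "\<dots> = integral ?R (\<lambda>x. (L $ 2 - partial 2 f x) * ?c x) + integral ?R (\<lambda>x. partial 2 f x * ?c x)"
    by (subst integral_add[symmetric]) (auto intro!: int continuous_intros cf simp: algebra_simps)
  finally have "\<bar>L $ 2 * (d * e ^ 3 / 6)\<bar> \<le> \<bar>integral ?R (\<lambda>x. (L $ 2 - partial 2 f x) * ?c x)\<bar>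
      + \<bar>integral ?R (\<lambda>x. f x * (l $ 2 + u $ 2 - 2 * x $ 2))\<bar>"
    unfolding parts by linarith
  also have "\<bar>integral ?R (\<lambda>x. (L $ 2 - partial 2 f x) * ?c x)\<bar> \<le> integral ?R (\<lambda>x. e ^ 2 * norm (grad f x - L))"
  proof (rule integral_abs_le)
    fix x assume x: "x \<in> ?R"
    have "\<bar>L $ 2 - partial 2 f x\<bar> \<le> norm (grad f x - L)"
      using component_le_norm_cart[of "grad f x - L" 2] by (simp add: grad_def abs_minus_commute)
    moreover have "\<bar>?c x\<bar> \<le> e ^ 2"
      using x unfolding abs_mult power2_eq_square e_def
      by (intro mult_mono) (auto simp: mem_cbox_2)
    ultimately show "\<bar>(L $ 2 - partial 2 f x) * ?c x\<bar> \<le> e ^ 2 * norm (grad f x - L)"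
      unfolding abs_mult[of "L $ 2 - partial 2 f x"] by (subst mult.commute) (intro mult_mono; simp)
  qed (auto intro!: int continuous_intros cf)
  also have "\<dots> = e ^ 2 * w" by (simp add: w_def)
  also have "\<bar>integral ?R (\<lambda>x. f x * (l $ 2 + u $ 2 - 2 * x $ 2))\<bar> \<le> integral ?R (\<lambda>x. e * \<bar>f x\<bar>)"
  proof (rule integral_abs_le)
    fix x assume x: "x \<in> ?R"
    then have "\<bar>l $ 2 + u $ 2 - 2 * x $ 2\<bar> \<le> e" by (auto simp: mem_cbox_2 e_def abs_le_iff)
    then show "\<bar>f x * (l $ 2 + u $ 2 - 2 * x $ 2)\<bar> \<le> e * \<bar>f x\<bar>"
      unfolding abs_mult by (subst mult.commute) (intro mult_right_mono; simp)
  qed (auto intro!: int continuous_intros cf)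
  also have "\<dots> = e * integral ?R (\<lambda>x. \<bar>f x\<bar>)" by simp
  also have "\<dots> \<le> e * (d * (b + integral ?R (\<lambda>x. \<bar>partial 1 f x\<bar>)))"
    using integral_abs_le_side[OF f lu(1,2)] de unfolding d_def b_def by (intro mult_left_mono) auto
  also have "\<dots> \<le> e * (d * (b + (\<bar>L $ 1\<bar> * (d * e) + w)))"
  proof -
    have "integral ?R (\<lambda>x. \<bar>partial 1 f x\<bar>) \<le> integral ?R (\<lambda>x. \<bar>L $ 1\<bar> + norm (grad f x - L))"
    proof (rule integral_le)
      fix x
      show "\<bar>partial 1 f x\<bar> \<le> \<bar>L $ 1\<bar> + norm (grad f x - L)"
        using component_le_norm_cart[of "grad f x - L" 1] by (simp add: grad_def)
    qed (auto intro!: int continuous_intros cf)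
    also have "\<dots> = \<bar>L $ 1\<bar> * (d * e) + w"
      using lu by (subst integral_add) (auto intro!: int continuous_intros cf simp: measure_cbox_2 d_def e_def w_def)
    finally show ?thesis using de by (intro mult_left_mono add_left_mono) auto
  qed
  finally show ?thesis using de by (simp add: abs_mult)
qed

section \<open>The tangential derivative at a corner\<close>

lemma cornersD: "p \<in> corners \<Longrightarrow> p $ i = 1 \<or> p $ i = -1"
  using exhaust_2[of i] by (auto simp: corners_def)

lemma Q_eq: "x \<in> Q \<longleftrightarrow> (\<forall>i. \<bar>x $ i\<bar> \<le> 1)"
  by (auto simp: Q_def mem_cbox_2 forall_2 abs_le_iff)

lemma interior_Q: "interior Q = box (vector [-1, -1]) (vector [1, 1])"
  by (simp add: Q_def)

text \<open>Width and height are independent parameters: the width alone shrinks in the tangential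
  estimate, while the perturbation lives on a square.\<close>

lemma corner_box:
  assumes p: "p \<in> corners" and d: "0 < d" "d \<le> 1" "0 < e" "e \<le> 1"
  obtains l u where "cbox l u \<subseteq> Q" "p \<in> cbox l u" "u $ 1 - l $ 1 = d" "u $ 2 - l $ 2 = e"
    and "\<forall>i. l $ i = p $ i \<or> u $ i = p $ i"
    and "\<forall>x\<in>cbox l u. dist x p \<le> d + e"
proof
  let ?l = "vector [if p $ 1 = 1 then 1 - d else -1, if p $ 2 = 1 then 1 - e else -1] :: real^2"
  let ?u = "vector [if p $ 1 = 1 then 1 else -1 + d, if p $ 2 = 1 then 1 else -1 + e] :: real^2"
  note c = cornersD[OF p, of 1] cornersD[OF p, of 2]
  show "cbox ?l ?u \<subseteq> Q" using c d by (auto simp: mem_cbox_2 Q_eq forall_2)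
  show "p \<in> cbox ?l ?u" using c d by (auto simp: mem_cbox_2)
  show "?u $ 1 - ?l $ 1 = d" "?u $ 2 - ?l $ 2 = e" using c by auto
  show "\<forall>i. ?l $ i = p $ i \<or> ?u $ i = p $ i" using c by (auto simp: forall_2)
  show "\<forall>x\<in>cbox ?l ?u. dist x p \<le> d + e"
  proof
    fix x assume that: "x \<in> cbox ?l ?u"
    have "dist x p \<le> \<bar>x $ 1 - p $ 1\<bar> + \<bar>x $ 2 - p $ 2\<bar>"
      using norm_le_l1_cart[of "x - p"] by (simp add: dist_norm UNIV_2)
    also have "\<dots> \<le> d + e"
    proof (rule add_mono)
      show "\<bar>x $ 1 - p $ 1\<bar> \<le> d" using that c(1) d(1) by (auto simp: mem_cbox_2 abs_le_iff)
      show "\<bar>x $ 2 - p $ 2\<bar> \<le> e" using that c(2) d(3) by (auto simp: mem_cbox_2 abs_le_iff)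
    qed
    finally show "dist x p \<le> d + e" .
  qed
qed

lemma nn_integral_cbox_continuous:
  fixes f :: "'a::euclidean_space \<Rightarrow> real"
  assumes f: "continuous_on (cbox l u) f" and pos: "\<And>x. 0 \<le> f x"
  shows "(\<integral>\<^sup>+x\<in>cbox l u. ennreal (f x) \<partial>lebesgue) = ennreal (integral (cbox l u) f)"
proof -
  have "(f has_integral integral (cbox l u) f) (cbox l u)"
    by (intro integrable_integral integrable_continuous f)
  from nn_integral_has_integral_lebesgue[OF pos this]
  have "(\<integral>\<^sup>+x. ennreal (indicator (cbox l u) x * f x) \<partial>lborel) = ennreal (integral (cbox l u) f)" .
  moreover have "ennreal (f x) * indicator (cbox l u) x = ennreal (indicator (cbox l u) x * f x)" for x
    by (simp add: indicator_def)
  ultimately show ?thesis by (simp add: nn_integral_completion)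
qed

lemma integral_le_by_square:
  fixes m :: "'a::euclidean_space \<Rightarrow> real"
  assumes m: "continuous_on (cbox l u) m" "\<And>x. 0 \<le> m x" and "\<eta> > 0"
    and sq: "(\<integral>\<^sup>+x\<in>cbox l u. ennreal ((m x)\<^sup>2) \<partial>lebesgue) \<le> ennreal (\<eta>\<^sup>2)"
  shows "integral (cbox l u) m \<le> \<eta> * measure lborel (cbox l u) + \<eta>"
  \<comment> \<open>because \<open>m \<le> \<eta> + m\<^sup>2 / \<eta>\<close>\<close>
proof -
  have c2: "continuous_on (cbox l u) (\<lambda>x. (m x)\<^sup>2)" using m(1) by (intro continuous_intros)
  have "integral (cbox l u) m \<le> integral (cbox l u) (\<lambda>x. \<eta> + (m x)\<^sup>2 / \<eta>)"
  proof (rule integral_le)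
    fix x
    have "0 \<le> (m x - \<eta> / 2)\<^sup>2 + \<eta>\<^sup>2 * 3 / 4" by simp
    then have "\<eta> * m x \<le> \<eta> * \<eta> + (m x)\<^sup>2" by (simp add: power2_eq_square algebra_simps)
    then show "m x \<le> \<eta> + (m x)\<^sup>2 / \<eta>" using \<open>\<eta> > 0\<close> by (simp add: field_simps)
  qed (use \<open>\<eta> > 0\<close> in \<open>auto intro!: integrable_continuous continuous_intros m(1)\<close>)
  also have "\<dots> = \<eta> * measure lborel (cbox l u) + integral (cbox l u) (\<lambda>x. (m x)\<^sup>2) / \<eta>"
    using \<open>\<eta> > 0\<close> by (subst integral_add) (auto intro!: integrable_continuous continuous_intros m(1))
  also have "integral (cbox l u) (\<lambda>x. (m x)\<^sup>2) \<le> \<eta>\<^sup>2"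
    using sq by (simp add: nn_integral_cbox_continuous[OF c2])
  finally show ?thesis
    using \<open>\<eta> > 0\<close> by (simp add: power2_eq_square divide_right_mono)
qed

lemma side_1: "side 1 a t = vector [a, t]"
  by (simp add: side_def vector_2_eq)

text \<open>\<open>vertical_derivative_bound\<close> is applied to the smooth functions that define
  the trace. Their distance to \<open>\<sigma>\<close>, measured by \<open>\<eta>\<close>,
  disappears in the limit, and so does the boundary term because the trace vanishes on the side.
  What remains is the deviation \<open>\<epsilon>\<close> of the weak gradient from
  \<open>L\<close>.\<close>

lemma tangential_derivative_estimate:
  assumes zt: "zero_trace_on bdryQ1 \<sigma>"
    and lu: "cbox l u \<subseteq> Q" "l $ 1 \<le> u $ 1" "l $ 2 \<le> u $ 2" "l $ 1 = a \<or> u $ 1 = a" "a \<in> {-1, 1}"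
    and near: "AE x in lebesgue. x \<in> cbox l u \<longrightarrow> norm (wgrad (interior Q) \<sigma> x - L) \<le> \<epsilon>"
    and "\<epsilon> > 0"
  defines "d \<equiv> u $ 1 - l $ 1" and "e \<equiv> u $ 2 - l $ 2"
  shows "\<bar>L $ 2\<bar> * (d * e ^ 3 / 6) \<le> e ^ 2 * (\<epsilon> * (d * e)) + e * (d * (\<bar>L $ 1\<bar> * (d * e) + \<epsilon> * (d * e)))"
proof -
  have de: "d \<ge> 0" "e \<ge> 0" using lu by (auto simp: d_def e_def)
  let ?R = "cbox l u"
  have meas: "measure lborel ?R = d * e" using lu by (simp add: measure_cbox_2 d_def e_def)
  obtain \<tau> \<phi> where sm: "\<And>n::nat. smooth (\<phi> n)"
    and N: "(\<lambda>n. \<integral>\<^sup>+x\<in>Q. ennreal ((\<phi> n x - \<sigma> x)\<^sup>2 + (norm (grad (\<phi> n) x - wgrad (interior Q) \<sigma> x))\<^sup>2) \<partial>lebesgue)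
         \<longlonglongrightarrow> 0" (is "?N \<longlonglongrightarrow> 0")
    and B: "(\<lambda>n. \<Sum>i\<in>UNIV. \<Sum>a\<in>{-1, 1}.
              \<integral>\<^sup>+t\<in>{-1..1}. ennreal ((\<phi> n (side i a t) - \<tau> (side i a t))\<^sup>2) \<partial>lborel) \<longlonglongrightarrow> 0" (is "?B \<longlonglongrightarrow> 0")
    and \<tau>: "\<And>i a. a \<in> {-1, 1} \<Longrightarrow> AE t in lborel. t \<in> {-1..1} \<and> side i a t \<in> bdryQ1 \<longrightarrow> \<tau> (side i a t) = 0"
    using zt unfolding zero_trace_on_def has_trace_def by blast
  have \<tau>0: "AE t in lborel. t \<in> {-1..1} \<longrightarrow> \<tau> (side 1 a t) = 0"
    using \<tau>[OF lu(5), of 1] by eventually_elim (use lu(5) in \<open>auto simp: side_1 bdryQ1_def\<close>)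
  have main: "\<bar>L $ 2\<bar> * (d * e ^ 3 / 6) \<le> e ^ 2 * (\<epsilon> * (d * e) + (\<eta> * (d * e) + \<eta>))
      + e * (d * ((\<eta> * e + \<eta>) + (\<bar>L $ 1\<bar> * (d * e) + (\<epsilon> * (d * e) + (\<eta> * (d * e) + \<eta>)))))" if "\<eta> > 0" for \<eta>
  proof -
    have "\<forall>\<^sub>F n in sequentially. ?N n < ennreal (\<eta>\<^sup>2)"
      using order_tendstoD(2)[OF N, of "ennreal (\<eta>\<^sup>2)"] that by simp
    moreover have "\<forall>\<^sub>F n in sequentially. ?B n < ennreal (\<eta>\<^sup>2)"
      using order_tendstoD(2)[OF B, of "ennreal (\<eta>\<^sup>2)"] that by simp
    ultimately have "\<forall>\<^sub>F n in sequentially. ?N n < ennreal (\<eta>\<^sup>2) \<and> ?B n < ennreal (\<eta>\<^sup>2)"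
      by (rule eventually_conj)
    then obtain n where n: "?N n < ennreal (\<eta>\<^sup>2)" "?B n < ennreal (\<eta>\<^sup>2)"
      unfolding eventually_sequentially by blast
    let ?f = "\<phi> n"
    \<comment> \<open>The excess of |grad f - L| over \<open>\<epsilon>\<close> is at most the
      distance from grad f to the weak gradient, hence small in the mean square sense. Subtracting
      \<open>\<epsilon>\<close> first avoids integrating \<open>wgrad\<close>, and the excess is
      continuous.\<close>
    let ?m = "\<lambda>x. max 0 (norm (grad ?f x - L) - \<epsilon>)"
    have cm: "continuous_on ?R ?m"
      by (intro continuous_intros continuous_on_grad sm)
    have "(\<integral>\<^sup>+x\<in>?R. ennreal ((?m x)\<^sup>2) \<partial>lebesgue) \<le> ?N n"
    proof (rule nn_integral_mono_AE)
      show "AE x in lebesgue. ennreal ((?m x)\<^sup>2) * indicator ?R x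
        \<le> ennreal ((\<phi> n x - \<sigma> x)\<^sup>2 + (norm (grad (\<phi> n) x - wgrad (interior Q) \<sigma> x))\<^sup>2) * indicator Q x"
        using near
      proof eventually_elim
        fix x assume *: "x \<in> ?R \<longrightarrow> norm (wgrad (interior Q) \<sigma> x - L) \<le> \<epsilon>"
        show "ennreal ((?m x)\<^sup>2) * indicator ?R x
          \<le> ennreal ((\<phi> n x - \<sigma> x)\<^sup>2 + (norm (grad (\<phi> n) x - wgrad (interior Q) \<sigma> x))\<^sup>2) * indicator Q x"
        proof (cases "x \<in> ?R")
          case True
          have "norm (grad ?f x - L) \<le> norm (grad ?f x - wgrad (interior Q) \<sigma> x) + norm (wgrad (interior Q) \<sigma> x - L)"
            using norm_triangle_ineq[of "grad ?f x - wgrad (interior Q) \<sigma> x" "wgrad (interior Q) \<sigma> x - L"] by simp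
          then have "?m x \<le> norm (grad ?f x - wgrad (interior Q) \<sigma> x)" using * True by simp
          then have "(?m x)\<^sup>2 \<le> (norm (grad ?f x - wgrad (interior Q) \<sigma> x))\<^sup>2" by (intro power_mono) auto
          then have "(?m x)\<^sup>2 \<le> (\<phi> n x - \<sigma> x)\<^sup>2 + (norm (grad (\<phi> n) x - wgrad (interior Q) \<sigma> x))\<^sup>2"
            using zero_le_power2[of "\<phi> n x - \<sigma> x"] by linarith
          moreover have "x \<in> Q" using True lu(1) by blast
          ultimately show ?thesis using True by (simp add: ennreal_leI del: ennreal_plus)
        qed auto
      qed
    qed
    then have "(\<integral>\<^sup>+x\<in>?R. ennreal ((?m x)\<^sup>2) \<partial>lebesgue) \<le> ennreal (\<eta>\<^sup>2)" using n(1) by simp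
    from integral_le_by_square[OF cm _ that this]
    have m: "integral ?R ?m \<le> \<eta> * (d * e) + \<eta>" by (simp add: meas)
    have w: "integral ?R (\<lambda>x. norm (grad ?f x - L)) \<le> \<epsilon> * (d * e) + (\<eta> * (d * e) + \<eta>)"
    proof -
      have "integral ?R (\<lambda>x. norm (grad ?f x - L)) \<le> integral ?R (\<lambda>x. \<epsilon> + ?m x)"
        by (intro integral_le integrable_continuous continuous_intros continuous_on_grad sm) auto
      also have "\<dots> = \<epsilon> * (d * e) + integral ?R ?m"
        by (subst integral_add) (auto intro!: integrable_continuous cm simp: meas)
      finally show ?thesis using m by simp
    qed
    let ?b = "\<lambda>t. \<bar>?f (vector [a, t])\<bar>"
    have l2: "{l $ 2..u $ 2} \<subseteq> {-1..1}"
    proof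
      fix t assume t: "t \<in> {l $ 2..u $ 2}"
      then have "(vector [l $ 1, t] :: real^2) \<in> cbox l u" using lu(2) by (auto simp: mem_cbox_2)
      then have "(vector [l $ 1, t] :: real^2) \<in> Q" using lu(1) by blast
      then show "t \<in> {-1..1}" by (auto simp: Q_eq forall_2 abs_le_iff)
    qed
    have cb: "continuous_on (cbox (l $ 2) (u $ 2)) ?b"
      by (intro continuous_intros continuous_on_compose2[OF smooth_continuous_on[OF sm, of UNIV n]]) auto
    \<comment> \<open>Almost everywhere on the side the trace is 0, so the square of
      \<open>\<phi> n\<close> there is the square of its distance to the trace, one of the four
      summands of \<open>?B n\<close>.\<close>
    have "(\<integral>\<^sup>+t\<in>cbox (l $ 2) (u $ 2). ennreal ((?b t)\<^sup>2) \<partial>lebesgue)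
        \<le> (\<integral>\<^sup>+t\<in>{-1..1}. ennreal ((\<phi> n (side 1 a t) - \<tau> (side 1 a t))\<^sup>2) \<partial>lborel)"
      unfolding nn_integral_completion
    proof (rule nn_integral_mono_AE)
      show "AE t in lborel. ennreal ((?b t)\<^sup>2) * indicator (cbox (l $ 2) (u $ 2)) t
          \<le> ennreal ((\<phi> n (side 1 a t) - \<tau> (side 1 a t))\<^sup>2) * indicator {-1..1} t"
        using \<tau>0
      proof eventually_elim
        fix t :: real assume "t \<in> {-1..1} \<longrightarrow> \<tau> (side 1 a t) = 0"
        then show "ennreal ((?b t)\<^sup>2) * indicator (cbox (l $ 2) (u $ 2)) t
          \<le> ennreal ((\<phi> n (side 1 a t) - \<tau> (side 1 a t))\<^sup>2) * indicator {-1..1} t"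
          using l2 by (cases "t \<in> {l $ 2..u $ 2}") (auto simp: side_1)
      qed
    qed
    also have "\<dots> \<le> (\<Sum>a\<in>{-1, 1}. \<integral>\<^sup>+t\<in>{-1..1}. ennreal ((\<phi> n (side 1 a t) - \<tau> (side 1 a t))\<^sup>2) \<partial>lborel)"
      using lu(5) by (intro member_le_sum) auto
    also have "\<dots> \<le> ?B n"
      by (intro member_le_sum[of 1 UNIV "\<lambda>i. \<Sum>a\<in>{-1, 1}. \<integral>\<^sup>+t\<in>{-1..1}. ennreal ((\<phi> n (side i a t) - \<tau> (side i a t))\<^sup>2) \<partial>lborel"]) auto
    finally have "(\<integral>\<^sup>+t\<in>cbox (l $ 2) (u $ 2). ennreal ((?b t)\<^sup>2) \<partial>lebesgue) \<le> ennreal (\<eta>\<^sup>2)"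
      using n(2) by simp
    from integral_le_by_square[OF cb _ that this]
    have b: "integral {l $ 2..u $ 2} ?b \<le> \<eta> * e + \<eta>" using lu(3) by (simp add: box_real e_def)
    have "\<bar>L $ 2\<bar> * (d * e ^ 3 / 6) \<le> e ^ 2 * integral ?R (\<lambda>x. norm (grad ?f x - L))
        + e * (d * (integral {l $ 2..u $ 2} ?b + (\<bar>L $ 1\<bar> * (d * e) + integral ?R (\<lambda>x. norm (grad ?f x - L)))))"
      unfolding d_def e_def by (rule vertical_derivative_bound[OF sm]) (use lu in auto)
    also have "\<dots> \<le> e ^ 2 * (\<epsilon> * (d * e) + (\<eta> * (d * e) + \<eta>))
      + e * (d * ((\<eta> * e + \<eta>) + (\<bar>L $ 1\<bar> * (d * e) + (\<epsilon> * (d * e) + (\<eta> * (d * e) + \<eta>)))))"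
      using w b de by (intro add_mono mult_left_mono) auto
    finally show ?thesis .
  qed
  \<comment> \<open>The box stays fixed while \<open>\<eta>\<close> tends to 0, so every term
    containing \<open>\<eta>\<close> vanishes.\<close>
  have "((\<lambda>\<eta>. e ^ 2 * (\<epsilon> * (d * e) + (\<eta> * (d * e) + \<eta>))
      + e * (d * ((\<eta> * e + \<eta>) + (\<bar>L $ 1\<bar> * (d * e) + (\<epsilon> * (d * e) + (\<eta> * (d * e) + \<eta>))))))
      \<longlongrightarrow> e ^ 2 * (\<epsilon> * (d * e) + (0 * (d * e) + 0))
      + e * (d * ((0 * e + 0) + (\<bar>L $ 1\<bar> * (d * e) + (\<epsilon> * (d * e) + (0 * (d * e) + 0)))))) (at_right 0)"
    by (intro tendsto_intros)
  from tendsto_lowerbound[OF this _ trivial_limit_at_right_real, of "\<bar>L $ 2\<bar> * (d * e ^ 3 / 6)"] main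
  show ?thesis by (simp add: eventually_at_filter)
qed

text \<open>After division by d e^2 the estimate reads |L_2| e / 6 <= \<epsilon> e + d (|L_1| +
  \<epsilon>). The height e depends only on \<open>\<epsilon>\<close>, so letting the width d tend
  to 0 removes L_1; then \<open>\<epsilon>\<close> is arbitrary.\<close>

lemma corner_tangential_derivative_0:
  assumes p: "p \<in> corners" and zt: "zero_trace_on bdryQ1 \<sigma>"
    and G: "AE x in lebesgue_on Q. G x = wgrad (interior Q) \<sigma> x"
    and cont: "continuous (at p within Q) G"
  shows "G p $ 2 = 0"
proof -
  have "\<bar>G p $ 2\<bar> / 6 \<le> \<epsilon>" if "\<epsilon> > 0" for \<epsilon>
  proof -
    obtain r where r: "r > 0" "\<And>x. x \<in> Q \<Longrightarrow> dist x p < r \<Longrightarrow> dist (G x) (G p) < \<epsilon>"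
      using cont \<open>\<epsilon> > 0\<close> unfolding continuous_within_eps_delta by blast
    \<comment> \<open>Points of the box have distance at most d + e <= 2 e from the corner, which is
      less than r.\<close>
    define e where "e = min 1 (r / 3)"
    have e: "0 < e" "e \<le> 1" "e \<le> r / 3" using r(1) by (auto simp: e_def)
    have "\<bar>G p $ 2\<bar> / 6 * e \<le> \<epsilon> * e + d * (\<bar>G p $ 1\<bar> + \<epsilon>)" if d: "0 < d" "d \<le> e" for d
    proof -
      obtain l u where lu: "cbox l u \<subseteq> Q" "p \<in> cbox l u" "u $ 1 - l $ 1 = d" "u $ 2 - l $ 2 = e"
        "\<forall>i. l $ i = p $ i \<or> u $ i = p $ i" "\<forall>x\<in>cbox l u. dist x p \<le> d + e"
        by (rule corner_box[OF p d(1) order_trans[OF d(2) e(2)] e(1,2)])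
      have "AE x in lebesgue. x \<in> Q \<longrightarrow> G x = wgrad (interior Q) \<sigma> x"
        using G by (simp add: AE_lebesgue_on_iff Q_def)
      then have "AE x in lebesgue. x \<in> cbox l u \<longrightarrow> norm (wgrad (interior Q) \<sigma> x - G p) \<le> \<epsilon>"
      proof eventually_elim
        fix x assume *: "x \<in> Q \<longrightarrow> G x = wgrad (interior Q) \<sigma> x"
        show "x \<in> cbox l u \<longrightarrow> norm (wgrad (interior Q) \<sigma> x - G p) \<le> \<epsilon>"
        proof
          assume x: "x \<in> cbox l u"
          then have "x \<in> Q" using lu(1) by blast
          moreover have "dist x p < r" using bspec[OF lu(6) x] d e r(1) by linarith
          ultimately show "norm (wgrad (interior Q) \<sigma> x - G p) \<le> \<epsilon>"
            using r(2)[of x] * by (simp add: dist_norm)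
        qed
      qed
      moreover have "l $ 1 \<le> u $ 1" "l $ 2 \<le> u $ 2" using lu(3,4) d(1) e(1) by linarith+
      ultimately have "\<bar>G p $ 2\<bar> * (d * e ^ 3 / 6) \<le> e ^ 2 * (\<epsilon> * (d * e))
          + e * (d * (\<bar>G p $ 1\<bar> * (d * e) + \<epsilon> * (d * e)))"
        using tangential_derivative_estimate[OF zt lu(1) _ _ spec[OF lu(5)]] cornersD[OF p, of 1] \<open>\<epsilon> > 0\<close>
        by (simp only: lu(3,4)) blast
      then have "(d * e ^ 2) * (\<bar>G p $ 2\<bar> / 6 * e) \<le> (d * e ^ 2) * (\<epsilon> * e + d * (\<bar>G p $ 1\<bar> + \<epsilon>))"
        by (simp add: algebra_simps power2_eq_square power3_eq_cube)
      then show ?thesis using d(1) e(1) by (subst (asm) mult_le_cancel_left_pos) auto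
    qed
    then have "\<forall>\<^sub>F d in at_right 0. \<bar>G p $ 2\<bar> / 6 * e \<le> \<epsilon> * e + d * (\<bar>G p $ 1\<bar> + \<epsilon>)"
      unfolding eventually_at_right_field using e(1) by (intro exI[of _ e]) auto
    moreover have "((\<lambda>d. \<epsilon> * e + d * (\<bar>G p $ 1\<bar> + \<epsilon>)) \<longlongrightarrow> \<epsilon> * e + 0 * (\<bar>G p $ 1\<bar> + \<epsilon>)) (at_right 0)"
      by (intro tendsto_intros)
    ultimately have "\<bar>G p $ 2\<bar> / 6 * e \<le> \<epsilon> * e + 0 * (\<bar>G p $ 1\<bar> + \<epsilon>)"
      by (intro tendsto_lowerbound[OF _ _ trivial_limit_at_right_real])
    then show ?thesis using e(1) by simp
  qed
  then have "\<bar>G p $ 2\<bar> / 6 \<le> 0" by (rule field_le_epsilon[of _ 0, simplified])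
  then show ?thesis by simp
qed

section \<open>Perturbations near a corner\<close>

definition bump :: "real \<Rightarrow> real" where
  "bump z = flat 1 (1 + z) * flat 1 (1 - z)"

text \<open>\<open>[:0, 0, 1:]\<close> is the polynomial that arises when \<open>flat 1\<close> is
  differentiated. The explicit form makes continuity, and with it boundedness, immediate.\<close>

definition bump' :: "real \<Rightarrow> real" where
  "bump' z = flat [:0, 0, 1:] (1 + z) * flat 1 (1 - z) - flat 1 (1 + z) * flat [:0, 0, 1:] (1 - z)"

lemma has_real_derivative_bump: "(bump has_real_derivative bump' z) (at z)"
proof -
  have d: "(flat 1 has_real_derivative flat [:0, 0, 1:] t) (at t)" for t
    using has_real_derivative_flat[of 1 t] by simp
  show ?thesis
    unfolding bump_def[abs_def] bump'_def
    by (auto intro!: derivative_eq_intros DERIV_chain2[OF d])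
qed

lemma continuous_on_flat: "continuous_on S (flat p)"
  by (meson DERIV_continuous_on has_field_derivative_at_within has_real_derivative_flat)

lemma continuous_on_bump [continuous_intros]:
  "continuous_on S f \<Longrightarrow> continuous_on S (\<lambda>x. bump (f x))"
  unfolding bump_def by (intro continuous_intros continuous_on_compose2[OF continuous_on_flat[of UNIV]]) auto

lemma bump_eq_0: "1 \<le> \<bar>z\<bar> \<Longrightarrow> bump z = 0" and bump'_eq_0: "1 \<le> \<bar>z\<bar> \<Longrightarrow> bump' z = 0"
  by (auto simp: bump_def bump'_def flat_def)

lemma bump_bounds: "0 \<le> bump z" "bump z \<le> 1"
  using flat_1_bounds by (auto simp: bump_def intro!: mult_le_one)

lemma bump'_bounded: obtains M where "M > 0" "\<And>z. \<bar>bump' z\<bar> \<le> M"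
proof -
  have "continuous_on {-1..1} bump'"
    unfolding bump'_def by (intro continuous_intros continuous_on_compose2[OF continuous_on_flat[of UNIV]]) auto
  then have "bounded (bump' ` {-1..1})"
    by (intro compact_imp_bounded compact_continuous_image) auto
  then obtain M where M: "\<forall>z\<in>{-1..1}. \<bar>bump' z\<bar> \<le> M" by (auto simp: bounded_iff)
  have "\<bar>bump' z\<bar> \<le> max M 1" for z
  proof (cases "1 \<le> \<bar>z\<bar>")
    case False
    then have "z \<in> {-1..1}" by auto
    then have "\<bar>bump' z\<bar> \<le> M" using M by blast
    then show ?thesis by simp
  qed (simp add: bump'_eq_0)
  then show ?thesis by (intro that[of "max M 1"]) auto
qed

lemma integral_bump_pos: "integral {-1..1} bump > 0"
proof -
  have c: "continuous_on {-1..1} bump" using continuous_on_bump[OF continuous_on_id] by simp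
  have "integral {-1..1} bump \<noteq> 0"
  proof
    assume "integral {-1..1} bump = 0"
    then have "bump 0 = 0"
      using integral_eq_0_iff[OF c] bump_bounds(1) by auto
    then show False by (simp add: bump_def flat_def)
  qed
  moreover have "0 \<le> integral {-1..1} bump"
    by (intro integral_nonneg integrable_continuous_real c bump_bounds)
  ultimately show ?thesis by simp
qed

lemma integral_bump_affine:
  assumes "r > 0" "u - l = r"
  shows "integral {l..u} (\<lambda>s. bump (2 / r * s + - (l + u) / r)) = r / 2 * integral {-1..1} bump"
proof -
  have "(bump has_integral integral {-1..1} bump) (cbox (-1) 1)"
    unfolding box_real
    by (intro integrable_integral integrable_continuous_real continuous_on_bump continuous_on_id)
  from has_integral_affinity[OF this, of "2 / r" "- (l + u) / r"] assms
  have "((\<lambda>s. bump (2 / r * s + - (l + u) / r)) has_integral r / 2 * integral {-1..1} bump)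
      ((\<lambda>x. (1 / (2 / r)) *\<^sub>R x + - ((1 / (2 / r)) *\<^sub>R (- (l + u) / r))) ` cbox (-1) 1)"
    by simp
  moreover have "(\<lambda>x. (1 / (2 / r)) *\<^sub>R x + - ((1 / (2 / r)) *\<^sub>R (- (l + u) / r))) ` cbox (-1) 1 = {l..u}"
    using assms by (subst image_affinity_cbox) (auto simp: box_real field_simps)
  ultimately show ?thesis by (simp add: integral_unique)
qed

lemma partial_cmult:
  fixes f :: "real^'n \<Rightarrow> real"
  shows "f differentiable (at x) \<Longrightarrow> partial i (\<lambda>x. c * f x) x = c * partial i f x"
  by (subst partial_mult) (auto simp: partial_def)

lemma partial_comp_component:
  "(a has_real_derivative d) (at (x $ i)) \<Longrightarrow> partial j (\<lambda>x. a (x $ i)) x = (if j = i then d else 0)"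
  using partial_eqI[OF has_derivative_comp_component, of a d x i j] by (auto simp: axis_def)

lemma smooth_bump: "smooth (\<lambda>x :: real^'n. bump (k * x $ i + m))"
proof -
  have "smooth (\<lambda>x :: real^'n. flat 1 (k * x $ i + (1 + m)) * flat 1 ((- k) * x $ i + (1 - m)))"
    by (intro smooth_mult smooth_flat)
  also have "(\<lambda>x :: real^'n. flat 1 (k * x $ i + (1 + m)) * flat 1 ((- k) * x $ i + (1 - m)))
      = (\<lambda>x. bump (k * x $ i + m))"
    by (simp add: bump_def algebra_simps)
  finally show ?thesis .
qed

lemma partial_bump: "partial j (\<lambda>x. bump (k * x $ i + m)) x = (if j = i then k * bump' (k * x $ i + m) else 0)"
proof -
  have "((\<lambda>t. bump (k * t + m)) has_real_derivative k * bump' (k * t + m)) (at t)" for t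
    by (rule DERIV_cong[OF DERIV_chain2[OF has_real_derivative_bump]])
       (auto intro!: derivative_eq_intros)
  from partial_comp_component[OF this] show ?thesis .
qed

text \<open>The factor \<open>r\<close> makes the bound on the gradient independent of the size of the box.\<close>

definition corner_bump :: "real^2 \<Rightarrow> real^2 \<Rightarrow> real^2 \<Rightarrow> real \<Rightarrow> real^2 \<Rightarrow> real" where
  "corner_bump p l u r x = r * (bump (2 / r * x $ 1 + - (l $ 1 + u $ 1) / r) * bump (1 / r * x $ 2 + - p $ 2 / r))"

lemma smooth_corner_bump: "smooth (corner_bump p l u r)"
  unfolding corner_bump_def[abs_def] by (intro smooth_cmult smooth_mult smooth_bump)

lemma partial_corner_bump:
  assumes "r > 0"
  shows "partial 1 (corner_bump p l u r) x
      = 2 * bump' (2 / r * x $ 1 + - (l $ 1 + u $ 1) / r) * bump (1 / r * x $ 2 + - p $ 2 / r)"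
    and "partial 2 (corner_bump p l u r) x
      = bump (2 / r * x $ 1 + - (l $ 1 + u $ 1) / r) * bump' (1 / r * x $ 2 + - p $ 2 / r)"
proof -
  let ?A = "\<lambda>x :: real^2. bump (2 / r * x $ 1 + - (l $ 1 + u $ 1) / r)"
    and ?B = "\<lambda>x :: real^2. bump (1 / r * x $ 2 + - p $ 2 / r)"
  have "partial j (corner_bump p l u r) x = r * (?A x * partial j ?B x + partial j ?A x * ?B x)" for j
    unfolding corner_bump_def[abs_def]
    by (simp only: partial_cmult partial_mult smooth_differentiable smooth_mult smooth_bump)
  then show "partial 1 (corner_bump p l u r) x
      = 2 * bump' (2 / r * x $ 1 + - (l $ 1 + u $ 1) / r) * bump (1 / r * x $ 2 + - p $ 2 / r)"
    and "partial 2 (corner_bump p l u r) x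
      = bump (2 / r * x $ 1 + - (l $ 1 + u $ 1) / r) * bump' (1 / r * x $ 2 + - p $ 2 / r)"
    unfolding partial_bump using assms by simp_all
qed

lemma corner_box_sides:
  assumes p: "p \<in> corners" and lu: "cbox l u \<subseteq> Q" "u $ 1 - l $ 1 = r" "u $ 2 - l $ 2 = r" "r > 0"
    "l $ 2 = p $ 2 \<or> u $ 2 = p $ 2"
  shows "l $ 2 = -1 \<and> p $ 2 = -1 \<or> u $ 2 = 1 \<and> p $ 2 = 1"
proof -
  have "l \<in> cbox l u" "u \<in> cbox l u" using lu by (auto simp: mem_cbox_2)
  then have "l \<in> Q" "u \<in> Q" using lu(1) by auto
  then have "\<bar>l $ 2\<bar> \<le> 1" "\<bar>u $ 2\<bar> \<le> 1" by (auto simp: Q_eq)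
  then show ?thesis using cornersD[OF p, of 2] lu(3-5) by auto
qed

lemma affine_outside_interval:
  fixes r :: real
  assumes "r > 0" "u - l = r" "x \<le> l \<or> u \<le> x"
  shows "1 \<le> \<bar>2 / r * x + - (l + u) / r\<bar>"
proof -
  have "r \<le> \<bar>2 * x - (l + u)\<bar>" using assms by auto
  then have "1 \<le> \<bar>2 * x - (l + u)\<bar> / r" using assms(1) by simp
  also have "\<dots> = \<bar>2 / r * x + - (l + u) / r\<bar>"
  proof -
    have "2 / r * x + - (l + u) / r = (2 * x - (l + u)) / r"
      using assms(1) by (simp add: field_simps)
    then show ?thesis using assms(1) by (simp only: abs_divide)
  qed
  finally show ?thesis .
qed

lemma corner_bump_eq_0:
  assumes "r > 0" "u $ 1 - l $ 1 = r" "x $ 1 \<le> l $ 1 \<or> u $ 1 \<le> x $ 1"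
  shows "corner_bump p l u r x = 0"
  using bump_eq_0[OF affine_outside_interval[OF assms]] by (simp add: corner_bump_def)

text \<open>In the second variable the bump is centred at the corner, so its support sticks out of
  \<open>Q\<close> across the free side. Only within \<open>Q\<close> is it confined to the
  box.\<close>

lemma grad_corner_bump_eq_0:
  assumes p: "p \<in> corners" and lu: "cbox l u \<subseteq> Q" "u $ 1 - l $ 1 = r" "u $ 2 - l $ 2 = r" "r > 0"
    "l $ 2 = p $ 2 \<or> u $ 2 = p $ 2"
    and x: "x \<in> Q" "x \<notin> cbox l u"
  shows "grad (corner_bump p l u r) x = 0"
proof (cases "x $ 1 \<le> l $ 1 \<or> u $ 1 \<le> x $ 1")
  case True
  note z = affine_outside_interval[OF lu(4,2) True]
  show ?thesis
    using bump_eq_0[OF z] bump'_eq_0[OF z]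
    by (simp add: vec_eq_iff forall_2 grad_def partial_corner_bump[OF lu(4)])
next
  case False
  then have "x $ 2 < l $ 2 \<or> u $ 2 < x $ 2" using x(2) by (auto simp: mem_cbox_2)
  then have "r \<le> \<bar>x $ 2 - p $ 2\<bar>"
    using corner_box_sides[OF p lu] x(1) lu(3) by (auto simp: Q_eq forall_2 abs_le_iff)
  then have "1 \<le> \<bar>x $ 2 - p $ 2\<bar> / r" using lu(4) by simp
  also have "\<dots> = \<bar>1 / r * x $ 2 + - p $ 2 / r\<bar>"
  proof -
    have "1 / r * x $ 2 + - p $ 2 / r = (x $ 2 - p $ 2) / r"
      using lu(4) by (simp add: field_simps)
    then show ?thesis using lu(4) by (simp only: abs_divide)
  qed
  finally have z: "1 \<le> \<bar>1 / r * x $ 2 + - p $ 2 / r\<bar>" .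
  show ?thesis
    using bump_eq_0[OF z] bump'_eq_0[OF z]
    by (simp add: vec_eq_iff forall_2 grad_def partial_corner_bump[OF lu(4)])
qed

text \<open>In the first variable the bump is centred in the box and vanishes at both ends, so the
  first integral is 0. In the second it is centred on the free side and vanishes on the opposite
  one, so up to sign the second integral is that of the bump along the free side: the height
  \<open>r * bump 0\<close> times half the width r times the integral of
  \<open>bump\<close>.\<close>

lemma integral_partial_corner_bump:
  assumes p: "p \<in> corners" and lu: "cbox l u \<subseteq> Q" "u $ 1 - l $ 1 = r" "u $ 2 - l $ 2 = r" "r > 0"
    "l $ 2 = p $ 2 \<or> u $ 2 = p $ 2"
  shows "integral (cbox l u) (partial 1 (corner_bump p l u r)) = 0"
    and "\<bar>integral (cbox l u) (partial 2 (corner_bump p l u r))\<bar> = bump 0 * integral {-1..1} bump / 2 * r\<^sup>2"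
proof -
  have le: "l $ 1 \<le> u $ 1" "l $ 2 \<le> u $ 2" using lu by auto
  show "integral (cbox l u) (partial 1 (corner_bump p l u r)) = 0"
    using lu by (simp add: integral_partial_1[OF smooth_corner_bump le(1)] corner_bump_eq_0)
  let ?A = "\<lambda>s. bump (2 / r * s + - (l $ 1 + u $ 1) / r)"
  \<comment> \<open>The sign records whether the free side through the corner is the upper or the
    lower one.\<close>
  define \<theta> :: real where "\<theta> = (if u $ 2 = p $ 2 then 1 else -1)"
  have "corner_bump p l u r (vector [s, u $ 2]) - corner_bump p l u r (vector [s, l $ 2])
      = (\<theta> * r * bump 0) * ?A s" for s
  proof (cases "u $ 2 = p $ 2")
    case True
    have "1 / r * l $ 2 + - p $ 2 / r = - 1"
      using True lu(3,4) by (simp add: field_simps)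
    moreover have "1 / r * u $ 2 + - p $ 2 / r = 0" using True by simp
    ultimately show ?thesis using True by (simp add: corner_bump_def \<theta>_def bump_eq_0)
  next
    case False
    then have *: "l $ 2 = p $ 2" using lu(5) by blast
    have "1 / r * u $ 2 + - p $ 2 / r = 1"
      using * lu(3,4) by (simp add: field_simps)
    moreover have "1 / r * l $ 2 + - p $ 2 / r = 0" using * by simp
    ultimately show ?thesis using False by (simp add: corner_bump_def \<theta>_def bump_eq_0 *)
  qed
  then have "integral (cbox l u) (partial 2 (corner_bump p l u r))
      = (\<theta> * r * bump 0) * (r / 2 * integral {-1..1} bump)"
    by (simp only: integral_partial_2[OF smooth_corner_bump le(2)] integral_bump_affine[OF lu(4,2)]
        Henstock_Kurzweil_Integration.integral_mult_right)
  also have "\<bar>\<dots>\<bar> = bump 0 * integral {-1..1} bump / 2 * r\<^sup>2"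
    using integral_bump_pos bump_bounds(1)[of 0] lu(4)
    by (simp add: abs_mult \<theta>_def power2_eq_square)
  finally show "\<bar>integral (cbox l u) (partial 2 (corner_bump p l u r))\<bar> = bump 0 * integral {-1..1} bump / 2 * r\<^sup>2" .
qed

section \<open>The energy as a function of the gradient\<close>

definition shear_density :: "(real \<Rightarrow> ereal) \<Rightarrow> real^2 \<Rightarrow> ereal" where
  "shear_density h v = ereal (1 / 2 * (1 + (v $ 1)\<^sup>2 + (1 + v $ 2)\<^sup>2)) + h (1 + v $ 2)"

lemma open_interior_Q [simp]: "open (interior Q)" "interior Q \<in> sets lebesgue"
  by (auto simp: interior_Q)

lemma AE_interior_Q:
  assumes "AE x in lebesgue_on (interior Q). P x"
  shows "AE x in lebesgue. x \<in> Q \<longrightarrow> x \<in> interior Q \<and> P x"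
proof -
  have "AE x in lebesgue. x \<in> interior Q \<longrightarrow> P x"
    using assms by (simp add: AE_lebesgue_on_iff)
  moreover have "AE x in lebesgue. x \<notin> Q - interior Q"
    using negligible_frontier_interval[of "vector [-1, -1] :: real^2" "vector [1, 1]"]
    unfolding negligible_iff_null_sets interior_Q by (intro AE_not_in) (simp add: Q_def)
  ultimately show ?thesis by eventually_elim auto
qed

lemma W_eq_shear_density:
  assumes "F $ 1 = axis 1 1" "F $ 2 = axis 2 1 + v"
  shows "W h F = shear_density h v"
proof -
  have F: "F $ 1 $ 1 = 1" "F $ 1 $ 2 = 0" "F $ 2 $ 1 = v $ 1" "F $ 2 $ 2 = 1 + v $ 2"
    using assms by (auto simp: axis_def)
  have "(norm F)\<^sup>2 = (\<Sum>i\<in>UNIV. \<Sum>j\<in>UNIV. F $ i $ j * F $ i $ j)"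
    by (simp add: power2_norm_eq_inner inner_vec_def)
  also have "\<dots> = 1 + (v $ 1)\<^sup>2 + (1 + v $ 2)\<^sup>2"
    by (simp add: UNIV_2 F power2_eq_square)
  finally show ?thesis by (simp add: W_def shear_density_def det_2 F)
qed

text \<open>The components of the shear map have weak gradients e_1 and e_2 + g, so any weak
  gradient \<open>g\<close> may replace the chosen ones. The integral is taken over the interior,
  where the measurability of \<open>g\<close> will be known.\<close>

lemma shear_energy_eq:
  assumes g: "has_weak_gradient (interior Q) \<sigma> g"
  shows "shear_energy h \<sigma> = (\<integral>\<^sup>+x. e2ennreal (shear_density h (g x)) * indicator (interior Q) x \<partial>lebesgue)"
  unfolding shear_energy_def
proof (rule nn_integral_cong_AE)
  have comp: "has_weak_gradient (interior Q) (\<lambda>y. y $ i) (\<lambda>x. axis i 1)" for i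
  proof -
    have "grad (\<lambda>y :: real^2. y $ i) = (\<lambda>x. axis i 1)"
      by (auto simp: grad_def partial_component axis_def vec_eq_iff)
    then show ?thesis
      using smooth_has_weak_gradient[OF smooth_component[of i] open_interior_Q(1)] by simp
  qed
  have w1: "AE x in lebesgue_on (interior Q). wgrad (interior Q) (\<lambda>y. shear \<sigma> y $ 1) x = axis 1 1"
  proof (rule wgrad_AE_eq)
    have "(\<lambda>y. shear \<sigma> y $ 1) = (\<lambda>y. y $ 1)" by (simp add: shear_def axis_def)
    then show "has_weak_gradient (interior Q) (\<lambda>y. shear \<sigma> y $ 1) (\<lambda>x. axis 1 1)" using comp by simp
  qed simp
  have w2: "AE x in lebesgue_on (interior Q). wgrad (interior Q) (\<lambda>y. shear \<sigma> y $ 2) x = axis 2 1 + g x"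
  proof (rule wgrad_AE_eq)
    have "(\<lambda>y. shear \<sigma> y $ 2) = (\<lambda>y. y $ 2 + \<sigma> y)" by (simp add: shear_def axis_def)
    then show "has_weak_gradient (interior Q) (\<lambda>y. shear \<sigma> y $ 2) (\<lambda>x. axis 2 1 + g x)"
      using has_weak_gradient_add[OF open_interior_Q(2) comp g] by simp
  qed simp
  have "AE x in lebesgue_on (interior Q). W h (wjacobian (interior Q) (shear \<sigma>) x) = shear_density h (g x)"
    using w1 w2
    by eventually_elim (rule W_eq_shear_density, auto simp: wjacobian_def)
  from AE_interior_Q[OF this]
  show "AE x in lebesgue. e2ennreal (W h (wjacobian (interior Q) (shear \<sigma>) x)) * indicator Q x =
      e2ennreal (shear_density h (g x)) * indicator (interior Q) x"
  proof eventually_elim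
    fix x assume "x \<in> Q \<longrightarrow> x \<in> interior Q \<and> W h (wjacobian (interior Q) (shear \<sigma>) x) = shear_density h (g x)"
    then show "e2ennreal (W h (wjacobian (interior Q) (shear \<sigma>) x)) * indicator Q x =
        e2ennreal (shear_density h (g x)) * indicator (interior Q) x"
      using interior_subset[of Q] by (cases "x \<in> Q") (auto simp: indicator_def)
  qed
qed

section \<open>Admissibility of smooth perturbations\<close>

lemma L2_add:
  fixes f g :: "real^'n \<Rightarrow> 'b::euclidean_space"
  assumes "L2 \<Omega> f" "L2 \<Omega> g"
  shows "L2 \<Omega> (\<lambda>x. f x + g x)"
  unfolding L2_def
proof
  show m: "(\<lambda>x. f x + g x) \<in> borel_measurable (lebesgue_on \<Omega>)"
    using assms unfolding L2_def by (intro borel_measurable_add) auto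
  show "integrable (lebesgue_on \<Omega>) (\<lambda>x. (norm (f x + g x))\<^sup>2)"
  proof (rule Bochner_Integration.integrable_bound)
    show "integrable (lebesgue_on \<Omega>) (\<lambda>x. 2 * (norm (f x))\<^sup>2 + 2 * (norm (g x))\<^sup>2)"
      using assms unfolding L2_def by (intro Bochner_Integration.integrable_add integrable_mult_right) auto
    show "(\<lambda>x. (norm (f x + g x))\<^sup>2) \<in> borel_measurable (lebesgue_on \<Omega>)"
      using m by measurable
    show "AE x in lebesgue_on \<Omega>. norm ((norm (f x + g x))\<^sup>2) \<le> norm (2 * (norm (f x))\<^sup>2 + 2 * (norm (g x))\<^sup>2)"
    proof (rule AE_I2)
      fix x
      have "(norm (f x + g x))\<^sup>2 \<le> (norm (f x) + norm (g x))\<^sup>2"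
        by (intro power_mono norm_triangle_ineq) auto
      also have "\<dots> \<le> 2 * (norm (f x))\<^sup>2 + 2 * (norm (g x))\<^sup>2"
        using zero_le_power2[of "norm (f x) - norm (g x)"] by (simp add: power2_eq_square algebra_simps)
      finally show "norm ((norm (f x + g x))\<^sup>2) \<le> norm (2 * (norm (f x))\<^sup>2 + 2 * (norm (g x))\<^sup>2)" by simp
    qed
  qed
qed

lemma L2_continuous:
  fixes f :: "real^2 \<Rightarrow> 'b::euclidean_space"
  assumes f: "continuous_on UNIV f"
  shows "L2 (interior Q) f"
  unfolding L2_def
proof
  show "f \<in> borel_measurable (lebesgue_on (interior Q))"
    using f by (intro measurable_restrict_space1 measurable_completion) (auto intro: borel_measurable_continuous_onI)
  have "L1_loc UNIV (\<lambda>x. (norm (f x))\<^sup>2)"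
    by (intro L1_loc_continuous continuous_intros f)
  then have "set_integrable lebesgue Q (\<lambda>x. (norm (f x))\<^sup>2)"
    by (simp add: L1_loc_iff Q_def compact_cbox)
  then have "set_integrable lebesgue (interior Q) (\<lambda>x. (norm (f x))\<^sup>2)"
    by (rule set_integrable_subset) (auto simp: interior_subset)
  then show "integrable (lebesgue_on (interior Q)) (\<lambda>x. (norm (f x))\<^sup>2)"
    by (subst integrable_restrict_space) (auto simp: set_integrable_def)
qed

lemma W12_add_smooth:
  assumes "\<sigma> \<in> W12 (interior Q)" "smooth \<phi>"
  shows "(\<lambda>x. \<sigma> x + \<phi> x) \<in> W12 (interior Q)"
proof -
  obtain g where g: "L2 (interior Q) \<sigma>" "has_weak_gradient (interior Q) \<sigma> g" "L2 (interior Q) g"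
    using assms(1) by (auto simp: W12_def)
  have "has_weak_gradient (interior Q) (\<lambda>x. \<sigma> x + \<phi> x) (\<lambda>x. g x + grad \<phi> x)"
    by (intro has_weak_gradient_add g smooth_has_weak_gradient assms(2)) auto
  moreover have "L2 (interior Q) (\<lambda>x. g x + grad \<phi> x)" "L2 (interior Q) (\<lambda>x. \<sigma> x + \<phi> x)"
    by (intro L2_add g L2_continuous continuous_on_grad smooth_continuous_on assms(2))+
  ultimately show ?thesis unfolding W12_def by blast
qed

lemma grad_add: "smooth f \<Longrightarrow> smooth g \<Longrightarrow> grad (\<lambda>x. f x + g x) x = grad f x + grad g x"
  by (simp add: grad_def vec_eq_iff partial_add smooth_differentiable)

text \<open>Adding the smooth function to the approximating sequence leaves both error integrals
  unchanged. For the gradient part this rests on \<open>wgrad\<close> being additive almost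
  everywhere, and that is where a weak gradient of \<open>\<sigma>\<close> is used.\<close>

lemma has_trace_add_smooth:
  assumes \<sigma>: "has_weak_gradient (interior Q) \<sigma> g" and \<tau>: "has_trace \<sigma> \<tau>" and \<phi>: "smooth \<phi>"
  shows "has_trace (\<lambda>x. \<sigma> x + \<phi> x) (\<lambda>x. \<tau> x + \<phi> x)"
proof -
  obtain \<psi> where sm: "\<And>n::nat. smooth (\<psi> n)"
    and N: "(\<lambda>n. \<integral>\<^sup>+x\<in>Q. ennreal ((\<psi> n x - \<sigma> x)\<^sup>2 + (norm (grad (\<psi> n) x - wgrad (interior Q) \<sigma> x))\<^sup>2) \<partial>lebesgue)
         \<longlonglongrightarrow> 0"
    and B: "(\<lambda>n. \<Sum>i\<in>UNIV. \<Sum>a\<in>{-1, 1}.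
              \<integral>\<^sup>+t\<in>{-1..1}. ennreal ((\<psi> n (side i a t) - \<tau> (side i a t))\<^sup>2) \<partial>lborel) \<longlonglongrightarrow> 0"
    and m: "\<tau> \<in> borel_measurable borel"
    using \<tau> unfolding has_trace_def by blast
  have "has_weak_gradient (interior Q) (\<lambda>x. \<sigma> x + \<phi> x) (\<lambda>x. g x + grad \<phi> x)"
    by (intro has_weak_gradient_add \<sigma> smooth_has_weak_gradient \<phi>) auto
  then have "AE x in lebesgue_on (interior Q). wgrad (interior Q) (\<lambda>x. \<sigma> x + \<phi> x) x = g x + grad \<phi> x"
    by (rule wgrad_AE_eq[OF open_interior_Q(1)])
  moreover have "AE x in lebesgue_on (interior Q). wgrad (interior Q) \<sigma> x = g x"
    by (rule wgrad_AE_eq[OF open_interior_Q(1) \<sigma>])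
  ultimately have "AE x in lebesgue_on (interior Q).
      wgrad (interior Q) (\<lambda>x. \<sigma> x + \<phi> x) x = wgrad (interior Q) \<sigma> x + grad \<phi> x"
    by eventually_elim simp
  note ae = AE_interior_Q[OF this]
  have "(\<integral>\<^sup>+x\<in>Q. ennreal ((\<psi> n x + \<phi> x - (\<sigma> x + \<phi> x))\<^sup>2 + (norm (grad (\<lambda>x. \<psi> n x + \<phi> x) x
          - wgrad (interior Q) (\<lambda>x. \<sigma> x + \<phi> x) x))\<^sup>2) \<partial>lebesgue)
      = (\<integral>\<^sup>+x\<in>Q. ennreal ((\<psi> n x - \<sigma> x)\<^sup>2 + (norm (grad (\<psi> n) x - wgrad (interior Q) \<sigma> x))\<^sup>2) \<partial>lebesgue)" for n
  proof (rule nn_integral_cong_AE)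
    show "AE x in lebesgue. ennreal ((\<psi> n x + \<phi> x - (\<sigma> x + \<phi> x))\<^sup>2 + (norm (grad (\<lambda>x. \<psi> n x + \<phi> x) x
          - wgrad (interior Q) (\<lambda>x. \<sigma> x + \<phi> x) x))\<^sup>2) * indicator Q x =
        ennreal ((\<psi> n x - \<sigma> x)\<^sup>2 + (norm (grad (\<psi> n) x - wgrad (interior Q) \<sigma> x))\<^sup>2) * indicator Q x"
      using ae
    proof eventually_elim
      fix x assume "x \<in> Q \<longrightarrow> x \<in> interior Q \<and>
        wgrad (interior Q) (\<lambda>x. \<sigma> x + \<phi> x) x = wgrad (interior Q) \<sigma> x + grad \<phi> x"
      then show "ennreal ((\<psi> n x + \<phi> x - (\<sigma> x + \<phi> x))\<^sup>2 + (norm (grad (\<lambda>x. \<psi> n x + \<phi> x) x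
          - wgrad (interior Q) (\<lambda>x. \<sigma> x + \<phi> x) x))\<^sup>2) * indicator Q x =
        ennreal ((\<psi> n x - \<sigma> x)\<^sup>2 + (norm (grad (\<psi> n) x - wgrad (interior Q) \<sigma> x))\<^sup>2) * indicator Q x"
        by (cases "x \<in> Q") (simp_all add: grad_add[OF sm \<phi>])
    qed
  qed
  with N have "(\<lambda>n. \<integral>\<^sup>+x\<in>Q. ennreal ((\<psi> n x + \<phi> x - (\<sigma> x + \<phi> x))\<^sup>2 + (norm (grad (\<lambda>x. \<psi> n x + \<phi> x) x
          - wgrad (interior Q) (\<lambda>x. \<sigma> x + \<phi> x) x))\<^sup>2) \<partial>lebesgue) \<longlonglongrightarrow> 0"
    by simp
  moreover have "(\<lambda>n. \<Sum>i\<in>UNIV. \<Sum>a\<in>{-1, 1}. \<integral>\<^sup>+t\<in>{-1..1}.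
      ennreal ((\<psi> n (side i a t) + \<phi> (side i a t) - (\<tau> (side i a t) + \<phi> (side i a t)))\<^sup>2) \<partial>lborel) \<longlonglongrightarrow> 0"
    using B by (simp add: add_diff_add)
  moreover have "(\<lambda>x. \<tau> x + \<phi> x) \<in> borel_measurable borel"
    by (intro borel_measurable_add m borel_measurable_continuous_onI smooth_continuous_on \<phi>)
  ultimately show ?thesis
    unfolding has_trace_def using smooth_add[OF sm \<phi>] by (intro conjI exI[of _ "\<lambda>n x. \<psi> n x + \<phi> x"]) auto
qed

lemma zero_trace_on_add_smooth:
  assumes \<sigma>: "has_weak_gradient (interior Q) \<sigma> g" and z: "zero_trace_on \<Gamma> \<sigma>"
    and \<phi>: "smooth \<phi>" "\<And>x. x \<in> \<Gamma> \<Longrightarrow> \<phi> x = 0"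
  shows "zero_trace_on \<Gamma> (\<lambda>x. \<sigma> x + \<phi> x)"
proof -
  obtain \<tau> where \<tau>: "has_trace \<sigma> \<tau>"
    and ae: "\<And>i a. a \<in> {-1, 1} \<Longrightarrow> AE t in lborel. t \<in> {-1..1} \<and> side i a t \<in> \<Gamma> \<longrightarrow> \<tau> (side i a t) = 0"
    using z unfolding zero_trace_on_def by blast
  show ?thesis
    unfolding zero_trace_on_def
  proof (intro exI conjI allI ballI)
    show "has_trace (\<lambda>x. \<sigma> x + \<phi> x) (\<lambda>x. \<tau> x + \<phi> x)"
      by (rule has_trace_add_smooth[OF \<sigma> \<tau> \<phi>(1)])
    show "AE t in lborel. t \<in> {-1..1} \<and> side i a t \<in> \<Gamma> \<longrightarrow> \<tau> (side i a t) + \<phi> (side i a t) = 0"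
      if "a \<in> {-1, 1}" for i a
      using ae[OF that, of i] by eventually_elim (simp add: \<phi>(2))
  qed
qed

section \<open>Strict comparison of energies\<close>

lemma nn_integral_less_by_increment:
  fixes k :: "'a::euclidean_space \<Rightarrow> real" and w w' :: "'a \<Rightarrow> ennreal"
  assumes w: "w \<in> borel_measurable lebesgue" "w' \<in> borel_measurable lebesgue"
    and k: "continuous_on (cbox l u) k" "integral (cbox l u) k < 0"
    and ae: "AE x in lebesgue. w' x + ennreal (max 0 (- k x)) * indicator (cbox l u) x
        \<le> w x + ennreal (max 0 (k x)) * indicator (cbox l u) x"
    and fin: "integral\<^sup>N lebesgue w < \<infinity>"
  shows "integral\<^sup>N lebesgue w' < integral\<^sup>N lebesgue w"
proof -
  let ?n = "\<lambda>x. max 0 (- k x)" and ?p = "\<lambda>x. max 0 (k x)"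
  have c: "continuous_on (cbox l u) ?n" "continuous_on (cbox l u) ?p"
    using k(1) by (auto intro!: continuous_intros)
  have m: "(\<lambda>x. ennreal (?n x) * indicator (cbox l u) x) \<in> borel_measurable lebesgue"
    "(\<lambda>x. ennreal (?p x) * indicator (cbox l u) x) \<in> borel_measurable lebesgue"
  proof -
    have "(\<lambda>x. ennreal (indicator (cbox l u) x *\<^sub>R f x)) \<in> borel_measurable lebesgue"
      if "continuous_on (cbox l u) f" for f :: "'a \<Rightarrow> real"
      using borel_measurable_integrable[OF borel_integrable_compact[OF compact_cbox that]]
      by (intro measurable_compose[OF _ measurable_ennreal] measurable_completion)
    moreover have "ennreal (indicator (cbox l u) x *\<^sub>R f x) = ennreal (f x) * indicator (cbox l u) x" for f x
      by (simp add: indicator_def)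
    ultimately show "(\<lambda>x. ennreal (?n x) * indicator (cbox l u) x) \<in> borel_measurable lebesgue"
      "(\<lambda>x. ennreal (?p x) * indicator (cbox l u) x) \<in> borel_measurable lebesgue"
      using c by simp_all
  qed
  have "integral\<^sup>N lebesgue w' + ennreal (integral (cbox l u) ?n)
      = (\<integral>\<^sup>+x. w' x + ennreal (?n x) * indicator (cbox l u) x \<partial>lebesgue)"
    by (simp add: nn_integral_add w m nn_integral_cbox_continuous[OF c(1)])
  also have "\<dots> \<le> (\<integral>\<^sup>+x. w x + ennreal (?p x) * indicator (cbox l u) x \<partial>lebesgue)"
    by (rule nn_integral_mono_AE[OF ae])
  also have "\<dots> = integral\<^sup>N lebesgue w + ennreal (integral (cbox l u) ?p)"
    by (simp add: nn_integral_add w m nn_integral_cbox_continuous[OF c(2)])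
  finally have le: "integral\<^sup>N lebesgue w' + ennreal (integral (cbox l u) ?n)
      \<le> integral\<^sup>N lebesgue w + ennreal (integral (cbox l u) ?p)" .
  have "integral (cbox l u) k = integral (cbox l u) (\<lambda>x. ?p x - ?n x)"
    by (rule arg_cong[where f = "integral _"]) (auto simp: max_def)
  also have "\<dots> = integral (cbox l u) ?p - integral (cbox l u) ?n"
    using c by (intro integral_diff integrable_continuous)
  finally have lt: "integral (cbox l u) ?p < integral (cbox l u) ?n" using k(2) by simp
  have pos: "0 \<le> integral (cbox l u) ?p"
    using c by (intro integral_nonneg integrable_continuous) auto
  show ?thesis
  proof (rule ccontr)
    assume "\<not> ?thesis"
    then have "integral\<^sup>N lebesgue w + ennreal (integral (cbox l u) ?n)
        \<le> integral\<^sup>N lebesgue w + ennreal (integral (cbox l u) ?p)"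
      using le by (meson add_right_mono not_less order_trans)
    then show False
      using fin lt pos by (auto simp: ennreal_add_left_cancel_le)
  qed
qed

section \<open>Regularity of the density and its first-order expansion\<close>

lemma eCk_onD:
  assumes "eCk_on n {0<..} h" "n \<ge> 1"
  shows "0 < t \<Longrightarrow> h t = ereal (real_of_ereal (h t))"
    and "0 < t \<Longrightarrow> ((\<lambda>t. real_of_ereal (h t)) has_real_derivative ederiv 1 h t) (at t)"
    and "continuous_on {0<..} (ederiv 1 h)"
proof -
  let ?r = "\<lambda>t. real_of_ereal (h t)"
  have C: "Ck_on n {0<..} ?r" "\<forall>t\<in>{0<..}. \<bar>h t\<bar> \<noteq> \<infinity>"
    using assms(1)[unfolded eCk_on_def] by (rule conjunct2, rule conjunct1)
  show "h t = ereal (?r t)" if "0 < t"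
    using C(2) that by (simp add: ereal_real)
  show "(?r has_real_derivative ederiv 1 h t) (at t)" if "0 < t"
  proof -
    have "(deriv ^^ 0) ?r field_differentiable (at t)"
      using C(1)[unfolded Ck_on_def, THEN conjunct1, rule_format, of 0 t] that assms(2) by simp
    then show ?thesis by (simp add: ederiv_def DERIV_deriv_iff_field_differentiable)
  qed
  show "continuous_on {0<..} (ederiv 1 h)"
    using C(1)[unfolded Ck_on_def, THEN conjunct2, rule_format, OF assms(2)] unfolding ederiv_def .
qed

lemma borel_measurable_eCk:
  assumes h: "eCk_on n {0<..} h" "n \<ge> 1" and "H3 h"
  shows "h \<in> borel_measurable borel"
proof -
  let ?r = "\<lambda>t. real_of_ereal (h t)"
  have "continuous_on {0<..} ?r"
    by (rule DERIV_continuous_on[where D = "ederiv 1 h"])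
       (rule has_field_derivative_at_within, rule eCk_onD(2)[OF h], simp)
  then have m: "(\<lambda>t. indicator {0<..} t *\<^sub>R ?r t) \<in> borel_measurable borel"
    by (intro borel_measurable_continuous_on_indicator) auto
  have "h t = (if 0 < t then ereal (indicator {0<..} t *\<^sub>R ?r t) else \<infinity>)" for t
    using eCk_onD(1)[OF h, of t] \<open>H3 h\<close> by (auto simp: H3_def not_less)
  then have "h = (\<lambda>t. if 0 < t then ereal (indicator {0<..} t *\<^sub>R ?r t) else \<infinity>)" by blast
  also have "\<dots> \<in> borel_measurable borel"
    using m by measurable
  finally show ?thesis .
qed

lemma borel_measurable_shear_density:
  assumes "h \<in> borel_measurable borel"
  shows "shear_density h \<in> borel_measurable borel"
proof -
  have c: "(\<lambda>v::real^2. v $ i) \<in> borel_measurable borel" for i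
    by (intro borel_measurable_continuous_onI continuous_intros)
  have "(\<lambda>v::real^2. h (1 + v $ 2)) \<in> borel_measurable borel"
    using c by (intro measurable_compose[OF _ assms]) auto
  then show ?thesis
    unfolding shear_density_def[abs_def] using c[of 1] c[of 2] by measurable
qed

definition real_shear_density :: "(real \<Rightarrow> ereal) \<Rightarrow> real^2 \<Rightarrow> real" where
  "real_shear_density h v = 1 / 2 * (1 + (v $ 1)\<^sup>2 + (1 + v $ 2)\<^sup>2) + real_of_ereal (h (1 + v $ 2))"

lemma shear_density_eq_ereal:
  assumes "eCk_on n {0<..} h" "n \<ge> 1" "0 < 1 + v $ 2"
  shows "shear_density h v = ereal (real_shear_density h v)"
  unfolding shear_density_def real_shear_density_def
  by (subst eCk_onD(1)[OF assms]) simp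

lemma real_shear_density_nonneg: "H1 h \<Longrightarrow> 0 \<le> real_shear_density h v"
  unfolding real_shear_density_def H1_def by (intro add_nonneg_nonneg) (auto intro: real_of_ereal_pos)

text \<open>A first-order expansion with explicit errors. The coefficient 4 M \<epsilon> is 2 M
  \<epsilon> for g_1 against L_1, M \<epsilon> for g_2 against 0, and M \<epsilon> for the slope of
  \<open>h\<close> against its value at 1. The quadratic part of the density gives (v_1^2 + v_2^2) /
  2 <= 5 M^2 / 2; \<open>h\<close> is treated by the mean value theorem and adds no quadratic
  term.\<close>

lemma real_shear_density_increment:
  fixes g v L :: "real^2"
  assumes h: "eCk_on n {0<..} h" "n \<ge> 1"
    and \<delta>: "\<delta> \<le> 1 / 2" "\<And>t. \<bar>t - 1\<bar> \<le> \<delta> \<Longrightarrow> \<bar>ederiv 1 h t - ederiv 1 h 1\<bar> \<le> \<epsilon>"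
    and g: "\<bar>g $ 1 - L $ 1\<bar> \<le> \<epsilon>" "\<bar>g $ 2\<bar> \<le> \<epsilon>" "\<bar>g $ 2\<bar> \<le> \<delta> / 2"
    and v: "\<bar>v $ 1\<bar> \<le> 2 * M" "\<bar>v $ 2\<bar> \<le> M" "\<bar>s\<bar> * M \<le> \<delta> / 2"
  shows "real_shear_density h (g + s *\<^sub>R v) \<le> real_shear_density h g
    + (s * (L $ 1 * v $ 1 + (1 + ederiv 1 h 1) * v $ 2) + (\<bar>s\<bar> * (4 * M * \<epsilon>) + s\<^sup>2 * (5 * M\<^sup>2 / 2)))"
proof -
  let ?r = "\<lambda>t. real_of_ereal (h t)" and ?k = "ederiv 1 h"
  \<comment> \<open>The determinants before and after the perturbation. Both lie within
    \<open>\<delta>\<close> of 1, and \<delta> <= 1/2 keeps the segment between them in the region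
    where \<open>h\<close> is differentiable.\<close>
  define a where "a = 1 + g $ 2"
  define b where "b = a + s * v $ 2"
  have sv: "\<bar>s * v $ 2\<bar> \<le> \<delta> / 2"
    using v(2,3) by (metis abs_ge_zero abs_mult mult_left_mono order_trans)
  have M: "0 \<le> M" using v(2) by linarith
  have ab: "\<bar>a - 1\<bar> \<le> \<delta>" "\<bar>b - 1\<bar> \<le> \<delta>" using g(3) sv by (auto simp: a_def b_def)
  have mvt: "\<exists>z. \<bar>z - 1\<bar> \<le> \<delta> \<and> ?r y - ?r x = (y - x) * ?k z"
    if xy: "x < y" "\<bar>x - 1\<bar> \<le> \<delta>" "\<bar>y - 1\<bar> \<le> \<delta>" for x y
  proof -
    have "\<exists>z. x < z \<and> z < y \<and> ?r y - ?r x = (y - x) * ?k z"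
      using xy \<delta>(1) by (intro MVT2 eCk_onD(2)[OF h]) auto
    then show ?thesis using xy by (auto simp: abs_le_iff) (smt (verit))
  qed
  obtain z where z: "\<bar>z - 1\<bar> \<le> \<delta>" "?r b - ?r a = (b - a) * ?k z"
  proof (cases a b rule: linorder_cases)
    case less
    then show ?thesis using mvt[OF less ab] that by blast
  next
    case equal
    then show ?thesis using that[OF ab(1)] by simp
  next
    case greater
    then obtain z where "\<bar>z - 1\<bar> \<le> \<delta>" "?r a - ?r b = (a - b) * ?k z" using mvt[OF greater ab(2,1)] by blast
    then show ?thesis by (intro that[of z]) (auto simp: algebra_simps)
  qed
  have "real_shear_density h (g + s *\<^sub>R v) - real_shear_density h g
      = (1 / 2 * ((g $ 1 + s * v $ 1)\<^sup>2 - (g $ 1)\<^sup>2 + (b\<^sup>2 - a\<^sup>2))) + (?r b - ?r a)"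
    unfolding real_shear_density_def a_def b_def by (simp add: algebra_simps)
  also have "\<dots> = s * (L $ 1 * v $ 1 + (1 + ?k 1) * v $ 2)
      + (s * v $ 1 * (g $ 1 - L $ 1) + s * v $ 2 * g $ 2 + s * v $ 2 * (?k z - ?k 1))
      + s\<^sup>2 * (((v $ 1)\<^sup>2 + (v $ 2)\<^sup>2) / 2)"
    unfolding z(2) by (simp add: a_def b_def power2_eq_square field_simps)
  also have "\<dots> \<le> s * (L $ 1 * v $ 1 + (1 + ?k 1) * v $ 2)
      + \<bar>s\<bar> * (4 * M * \<epsilon>) + s\<^sup>2 * (5 * M\<^sup>2 / 2)"
  proof (intro add_mono order_refl)
    have b1: "s * x * y \<le> \<bar>s\<bar> * (X * Y)" if "\<bar>x\<bar> \<le> X" "\<bar>y\<bar> \<le> Y" for x y X Y :: real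
    proof -
      have "s * x * y \<le> \<bar>s\<bar> * (\<bar>x\<bar> * \<bar>y\<bar>)" by (metis abs_ge_self abs_mult mult.assoc)
      also have "\<dots> \<le> \<bar>s\<bar> * (X * Y)" using that by (intro mult_left_mono mult_mono) auto
      finally show ?thesis .
    qed
    have "s * v $ 1 * (g $ 1 - L $ 1) + s * v $ 2 * g $ 2 + s * v $ 2 * (?k z - ?k 1)
        \<le> \<bar>s\<bar> * ((2 * M) * \<epsilon>) + \<bar>s\<bar> * (M * \<epsilon>) + \<bar>s\<bar> * (M * \<epsilon>)"
      by (intro add_mono b1 v g \<delta>(2) z(1))
    then show "s * v $ 1 * (g $ 1 - L $ 1) + s * v $ 2 * g $ 2 + s * v $ 2 * (?k z - ?k 1)
        \<le> \<bar>s\<bar> * (4 * M * \<epsilon>)" by (simp add: algebra_simps)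
    have "(v $ 1)\<^sup>2 \<le> (2 * M)\<^sup>2" "(v $ 2)\<^sup>2 \<le> M\<^sup>2"
      using power_mono[OF v(1), of 2] power_mono[OF v(2), of 2] by simp_all
    then have "(v $ 1)\<^sup>2 + (v $ 2)\<^sup>2 \<le> 5 * M\<^sup>2" by (simp add: power_mult_distrib)
    then show "s\<^sup>2 * (((v $ 1)\<^sup>2 + (v $ 2)\<^sup>2) / 2) \<le> s\<^sup>2 * (5 * M\<^sup>2 / 2)"
      by (intro mult_left_mono) auto
  qed
  finally show ?thesis by simp
qed

text \<open>Outside the box the gradient is unchanged within \<open>Q\<close>, so the densities
  agree there whether finite or not. On the box both determinants are positive, so the densities are
  real numbers whose difference is bounded by \<open>k\<close>.\<close>

lemma shear_energy_decreases:
  assumes h: "eCk_on n {0<..} h" "n \<ge> 1" "H1 h" "H3 h"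
    and \<sigma>: "\<sigma> \<in> admissible h" "has_weak_gradient (interior Q) \<sigma> g" "L2 (interior Q) g"
    and \<phi>: "smooth \<phi>" and lu: "cbox l u \<subseteq> Q" and off: "\<And>x. x \<in> Q \<Longrightarrow> x \<notin> cbox l u \<Longrightarrow> grad \<phi> x = 0"
    and k: "continuous_on (cbox l u) k" "integral (cbox l u) k < 0"
    and ae: "AE x in lebesgue. x \<in> cbox l u \<longrightarrow> 0 < 1 + g x $ 2 \<and> 0 < 1 + (g x + grad \<phi> x) $ 2 \<and>
      real_shear_density h (g x + grad \<phi> x) \<le> real_shear_density h (g x) + k x"
  shows "shear_energy h (\<lambda>x. \<sigma> x + \<phi> x) < shear_energy h \<sigma>"
proof -
  have g': "has_weak_gradient (interior Q) (\<lambda>x. \<sigma> x + \<phi> x) (\<lambda>x. g x + grad \<phi> x)"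
    by (intro has_weak_gradient_add \<sigma>(2) smooth_has_weak_gradient \<phi>) auto
  have meas: "(\<lambda>x. e2ennreal (shear_density h (f x)) * indicator (interior Q) x) \<in> borel_measurable lebesgue"
    if "L2 (interior Q) f" for f
  proof -
    have D: "(\<lambda>v. e2ennreal (shear_density h v)) \<in> borel_measurable borel"
      using borel_measurable_shear_density[OF borel_measurable_eCk[OF h(1,2,4)]] by measurable
    have "f \<in> borel_measurable (lebesgue_on (interior Q))" using that by (simp add: L2_def)
    from measurable_compose[OF this D] show ?thesis
      by (subst (asm) borel_measurable_restrict_space_iff_ennreal) auto
  qed
  have L2': "L2 (interior Q) (\<lambda>x. g x + grad \<phi> x)"
    by (intro L2_add \<sigma>(3) L2_continuous continuous_on_grad \<phi>)
  have fin: "shear_energy h \<sigma> < \<infinity>" using \<sigma>(1) by (auto simp: admissible_def)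
  show ?thesis
    unfolding shear_energy_eq[OF \<sigma>(2)] shear_energy_eq[OF g']
  proof (rule nn_integral_less_by_increment[OF _ _ k])
    show "(\<integral>\<^sup>+x. e2ennreal (shear_density h (g x)) * indicator (interior Q) x \<partial>lebesgue) < \<infinity>"
      using fin by (simp add: shear_energy_eq[OF \<sigma>(2)])
    have "AE x in lebesgue_on (interior Q). True" by simp
    from AE_interior_Q[OF this] ae
    show "AE x in lebesgue. e2ennreal (shear_density h (g x + grad \<phi> x)) * indicator (interior Q) x
          + ennreal (max 0 (- k x)) * indicator (cbox l u) x
        \<le> e2ennreal (shear_density h (g x)) * indicator (interior Q) x
          + ennreal (max 0 (k x)) * indicator (cbox l u) x"
    proof eventually_elim
      fix x
      assume *: "x \<in> cbox l u \<longrightarrow> 0 < 1 + g x $ 2 \<and> 0 < 1 + (g x + grad \<phi> x) $ 2 \<and>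
          real_shear_density h (g x + grad \<phi> x) \<le> real_shear_density h (g x) + k x"
        and int: "x \<in> Q \<longrightarrow> x \<in> interior Q \<and> True"
      show "e2ennreal (shear_density h (g x + grad \<phi> x)) * indicator (interior Q) x
          + ennreal (max 0 (- k x)) * indicator (cbox l u) x
        \<le> e2ennreal (shear_density h (g x)) * indicator (interior Q) x
          + ennreal (max 0 (k x)) * indicator (cbox l u) x"
      proof (cases "x \<in> cbox l u")
        case True
        then have x: "x \<in> interior Q" using int lu by blast
        have e: "e2ennreal (shear_density h (g x)) = ennreal (real_shear_density h (g x))"
          "e2ennreal (shear_density h (g x + grad \<phi> x)) = ennreal (real_shear_density h (g x + grad \<phi> x))"
          using * True shear_density_eq_ereal[OF h(1,2)] by auto
        have "ennreal (real_shear_density h (g x + grad \<phi> x) + max 0 (- k x))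
            \<le> ennreal (real_shear_density h (g x) + max 0 (k x))"
          using * True by (intro ennreal_leI) auto
        then show ?thesis
          using True x real_shear_density_nonneg[OF h(3)] by (simp add: e)
      next
        case False
        then have "x \<in> interior Q \<Longrightarrow> grad \<phi> x = 0" using off interior_subset by blast
        then show ?thesis using False by (auto simp: indicator_def)
      qed
    qed
  qed (intro meas \<sigma>(3) L2')+
qed

theorem proposition19:
  fixes h\<^sub>0 :: "real \<Rightarrow> ereal" and \<sigma> :: "real^2 \<Rightarrow> real" and c :: real
  assumes "strongly_econvex h\<^sub>0"
    and "eCk_on 2 {t. h\<^sub>0 t < \<infinity>} h\<^sub>0"
    and "H1 h\<^sub>0" and "H2 h\<^sub>0" and "H3 h\<^sub>0"
    and "\<forall>\<mu>>0. \<exists>C>0. \<forall>t\<ge>\<mu>. \<bar>ederiv 2 h\<^sub>0 t\<bar> \<le> C"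
    and "1 + ederiv 1 h\<^sub>0 1 \<noteq> 0"
    and "\<sigma> \<in> admissible h\<^sub>0"
    and "\<forall>\<tau>\<in>admissible h\<^sub>0. shear_energy h\<^sub>0 \<sigma> \<le> shear_energy h\<^sub>0 \<tau>"
    and "c > 0"
    and "AE x in lebesgue_on Q. 1 + wgrad (interior Q) \<sigma> x $ 2 \<ge> c"
  shows "\<forall>p\<in>corners. \<not> (\<exists>G. (AE x in lebesgue_on Q. G x = wgrad (interior Q) \<sigma> x) \<and>
                             continuous (at p within Q) G)"
proof (intro ballI notI)
  fix p assume p: "p \<in> corners"
    and "\<exists>G. (AE x in lebesgue_on Q. G x = wgrad (interior Q) \<sigma> x) \<and> continuous (at p within Q) G"
  then obtain G where G: "AE x in lebesgue_on Q. G x = wgrad (interior Q) \<sigma> x"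
    and cont: "continuous (at p within Q) G" by blast
  have zt: "zero_trace_on bdryQ1 \<sigma>" and W: "\<sigma> \<in> W12 (interior Q)" "shear_energy h\<^sub>0 \<sigma> < \<infinity>"
    using assms(8) by (auto simp: admissible_def)
  have C: "eCk_on 3 {0<..} h\<^sub>0" using assms(4) by (simp add: H2_def)
  have L2: "G p $ 2 = 0" by (rule corner_tangential_derivative_0[OF p zt G cont])
  \<comment> \<open>Membership in \<open>W12\<close> supplies a square integrable weak gradient;
    almost everywhere on \<open>Q\<close> it agrees with \<open>wgrad\<close>, and hence with
    \<open>G\<close>.\<close>
  obtain g where g: "has_weak_gradient (interior Q) \<sigma> g" "L2 (interior Q) g" using W(1) by (auto simp: W12_def)
  have "AE x in lebesgue. x \<in> Q \<longrightarrow> x \<in> interior Q \<and> wgrad (interior Q) \<sigma> x = g x"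
    by (intro AE_interior_Q wgrad_AE_eq g(1)) simp
  moreover have "AE x in lebesgue. x \<in> Q \<longrightarrow> G x = wgrad (interior Q) \<sigma> x"
    using G by (simp add: AE_lebesgue_on_iff Q_def)
  ultimately have gG: "AE x in lebesgue. x \<in> Q \<longrightarrow> g x = G x"
    by eventually_elim auto
  define \<kappa> where "\<kappa> = 1 + ederiv 1 h\<^sub>0 1"
  define c0 where "c0 = bump 0 * integral {-1..1} bump / 2"
  have "bump 0 > 0" by (simp add: bump_def flat_def)
  then have c0: "c0 > 0" using integral_bump_pos by (simp add: c0_def)
  \<comment> \<open>Per unit of s_0 r^2, \<open>q\<close> is the first-order decrease of the energy.
    The choices of \<open>\<epsilon>\<close> and \<open>s0\<close> below let each of the two error
    terms consume at most a quarter of it.\<close>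
  define q where "q = \<bar>\<kappa>\<bar> * c0"
  have q: "q > 0" using c0 assms(7) by (simp add: q_def \<kappa>_def)
  obtain M where M: "M > 0" "\<And>z. \<bar>bump' z\<bar> \<le> M" using bump'_bounded by blast
  define \<epsilon> where "\<epsilon> = q / (16 * M)"
  have \<epsilon>: "\<epsilon> > 0" using q M by (simp add: \<epsilon>_def)
  obtain \<delta> where \<delta>: "\<delta> > 0" "\<delta> \<le> 1 / 2" "\<And>t. \<bar>t - 1\<bar> \<le> \<delta> \<Longrightarrow> \<bar>ederiv 1 h\<^sub>0 t - ederiv 1 h\<^sub>0 1\<bar> \<le> \<epsilon>"
  proof -
    have "isCont (ederiv 1 h\<^sub>0) 1"
      using eCk_onD(3)[OF C] by (simp add: continuous_on_eq_continuous_at)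
    then obtain d where d: "d > 0" "\<And>t. dist t 1 < d \<Longrightarrow> dist (ederiv 1 h\<^sub>0 t) (ederiv 1 h\<^sub>0 1) < \<epsilon>"
      using \<epsilon> unfolding continuous_at_eps_delta by blast
    show ?thesis
    proof (rule that[of "min (1 / 2) (d / 2)"])
      fix t assume "\<bar>t - 1\<bar> \<le> min (1 / 2) (d / 2)"
      then have "dist t 1 < d" using d(1) by (auto simp: dist_real_def)
      from d(2)[OF this] show "\<bar>ederiv 1 h\<^sub>0 t - ederiv 1 h\<^sub>0 1\<bar> \<le> \<epsilon>" by (simp add: dist_real_def)
    qed (use d(1) in auto)
  qed
  \<comment> \<open>The first bound keeps the perturbed determinant within \<open>\<delta>\<close>
    of 1, the second controls the quadratic error. Neither depends on the size r of the box.\<close>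
  define s0 where "s0 = min (\<delta> / (2 * M)) (q / (10 * M\<^sup>2))"
  have s0: "s0 > 0" "s0 * M \<le> \<delta> / 2" "s0 * (5 * M\<^sup>2 / 2) \<le> q / 4"
  proof -
    show "s0 > 0" using \<delta> M q by (simp add: s0_def)
    have "s0 * M \<le> \<delta> / (2 * M) * M" using M by (intro mult_right_mono) (auto simp: s0_def)
    then show "s0 * M \<le> \<delta> / 2" using M by simp
    have "s0 * (5 * M\<^sup>2 / 2) \<le> q / (10 * M\<^sup>2) * (5 * M\<^sup>2 / 2)"
      using M by (intro mult_right_mono) (auto simp: s0_def)
    then show "s0 * (5 * M\<^sup>2 / 2) \<le> q / 4" using M by simp
  qed
  obtain \<rho> where \<rho>: "\<rho> > 0" "\<And>x. x \<in> Q \<Longrightarrow> dist x p < \<rho> \<Longrightarrow> dist (G x) (G p) < min \<epsilon> (\<delta> / 2)"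
    using cont \<epsilon> \<delta>(1) unfolding continuous_within_eps_delta by (metis half_gt_zero min_less_iff_conj)
  define r where "r = min 1 (\<rho> / 3)"
  have r: "0 < r" "r \<le> 1" "r \<le> \<rho> / 3" using \<rho>(1) by (auto simp: r_def)
  obtain l u where lu: "cbox l u \<subseteq> Q" "p \<in> cbox l u" "u $ 1 - l $ 1 = r" "u $ 2 - l $ 2 = r"
    "\<forall>i. l $ i = p $ i \<or> u $ i = p $ i" "\<forall>x\<in>cbox l u. dist x p \<le> r + r"
    using corner_box[OF p r(1,2) r(1,2)] by blast
  let ?\<psi> = "corner_bump p l u r"
  note box = p lu(1,3,4) r(1) spec[OF lu(5)]
  define I where "I = integral (cbox l u) (partial 2 ?\<psi>)"
  have I: "\<bar>I\<bar> = c0 * r\<^sup>2"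
    unfolding I_def c0_def by (rule integral_partial_corner_bump(2)[OF box])
  \<comment> \<open>The sign makes the first-order term s \<kappa> I negative, whatever the signs of
    \<open>\<kappa>\<close> and of the integral \<open>I\<close>.\<close>
  define s where "s = - s0 * sgn (\<kappa> * I)"
  have "\<kappa> * I \<noteq> 0" using I c0 r(1) assms(7) by (auto simp: \<kappa>_def)
  then have s: "\<bar>s\<bar> = s0" "s\<^sup>2 = s0\<^sup>2" using s0(1) by (auto simp: s_def abs_mult sgn_real_def)
  have sI: "s * (\<kappa> * I) = - s0 * (q * r\<^sup>2)"
  proof -
    have "s * (\<kappa> * I) = - s0 * \<bar>\<kappa> * I\<bar>" by (simp add: s_def abs_sgn mult.commute mult.left_commute)
    then show ?thesis using I by (simp add: abs_mult q_def)
  qed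
  let ?K = "\<bar>s\<bar> * (4 * M * \<epsilon>) + s\<^sup>2 * (5 * M\<^sup>2 / 2)"
  \<comment> \<open>The linear part has the constant coefficients \<open>G p $ 1\<close> and
    \<open>\<kappa>\<close>, so its integral is exact: the horizontal derivative contributes 0 and
    the vertical one contributes s \<kappa> I. All deviations are in the constant
    \<open>?K\<close>.\<close>
  let ?k = "\<lambda>x. s * (G p $ 1 * partial 1 ?\<psi> x + \<kappa> * partial 2 ?\<psi> x) + ?K"
  let ?\<phi> = "\<lambda>x. s * ?\<psi> x"
  have sm: "smooth ?\<phi>" by (intro smooth_cmult smooth_corner_bump)
  have grad: "grad ?\<phi> x = s *\<^sub>R grad ?\<psi> x" for x
    by (simp add: grad_def vec_eq_iff partial_cmult smooth_differentiable smooth_corner_bump)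
  have cp: "continuous_on A (partial i ?\<psi>)" for A i
    by (intro smooth_continuous_on smooth_partial smooth_corner_bump)
  have int_k: "integral (cbox l u) ?k < 0"
  proof -
    have "integral (cbox l u) ?k = integral (cbox l u) (\<lambda>x. s * (G p $ 1 * partial 1 ?\<psi> x + \<kappa> * partial 2 ?\<psi> x)) + ?K * r\<^sup>2"
    proof (subst integral_add)
      show "(\<lambda>x. s * (G p $ 1 * partial 1 ?\<psi> x + \<kappa> * partial 2 ?\<psi> x)) integrable_on cbox l u"
        by (intro integrable_continuous continuous_intros cp)
    qed (use lu(3,4) r(1) in \<open>auto simp: measure_cbox_2 power2_eq_square\<close>)
    also have "integral (cbox l u) (\<lambda>x. s * (G p $ 1 * partial 1 ?\<psi> x + \<kappa> * partial 2 ?\<psi> x))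
        = s * (G p $ 1 * integral (cbox l u) (partial 1 ?\<psi>) + \<kappa> * integral (cbox l u) (partial 2 ?\<psi>))"
      by (simp add: integral_add integrable_continuous continuous_intros cp)
    also have "\<dots> = - s0 * (q * r\<^sup>2)"
      using integral_partial_corner_bump(1)[OF box] sI by (simp add: I_def)
    also have "- s0 * (q * r\<^sup>2) + ?K * r\<^sup>2 = (s0 * r\<^sup>2) * (- q + 4 * M * \<epsilon> + s0 * (5 * M\<^sup>2 / 2))"
      unfolding s by (simp add: power2_eq_square algebra_simps)
    also have "\<dots> < 0"
    proof (rule mult_pos_neg)
      show "0 < s0 * r\<^sup>2" using s0(1) r(1) by simp
      have "4 * M * \<epsilon> = q / 4" using M by (simp add: \<epsilon>_def)
      then show "- q + 4 * M * \<epsilon> + s0 * (5 * M\<^sup>2 / 2) < 0" using s0(3) q by linarith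
    qed
    finally show ?thesis .
  qed
  have lt: "shear_energy h\<^sub>0 (\<lambda>x. \<sigma> x + ?\<phi> x) < shear_energy h\<^sub>0 \<sigma>"
  proof (rule shear_energy_decreases[OF C _ assms(3,5,8) g sm lu(1) _ _ int_k])
    show "grad ?\<phi> x = 0" if "x \<in> Q" "x \<notin> cbox l u" for x
      using grad_corner_bump_eq_0[OF box that] by (simp add: grad)
    show "continuous_on (cbox l u) ?k" by (intro continuous_intros cp)
    show "AE x in lebesgue. x \<in> cbox l u \<longrightarrow> 0 < 1 + g x $ 2 \<and> 0 < 1 + (g x + grad ?\<phi> x) $ 2 \<and>
        real_shear_density h\<^sub>0 (g x + grad ?\<phi> x) \<le> real_shear_density h\<^sub>0 (g x) + ?k x"
      using gG
    proof eventually_elim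
      fix x assume gGx: "x \<in> Q \<longrightarrow> g x = G x"
      show "x \<in> cbox l u \<longrightarrow> 0 < 1 + g x $ 2 \<and> 0 < 1 + (g x + grad ?\<phi> x) $ 2 \<and>
        real_shear_density h\<^sub>0 (g x + grad ?\<phi> x) \<le> real_shear_density h\<^sub>0 (g x) + ?k x"
      proof
        assume x: "x \<in> cbox l u"
        then have xQ: "x \<in> Q" using lu(1) by blast
        have "dist x p < \<rho>" using bspec[OF lu(6) x] r \<rho>(1) by linarith
        then have "norm (g x - G p) < min \<epsilon> (\<delta> / 2)"
          using \<rho>(2)[OF xQ] gGx xQ by (simp add: dist_norm)
        then have n: "\<bar>(g x - G p) $ i\<bar> < \<epsilon>" "\<bar>(g x - G p) $ i\<bar> < \<delta> / 2" for i
          using component_le_norm_cart[of "g x - G p" i] by auto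
        have v: "\<bar>grad ?\<psi> x $ 1\<bar> \<le> 2 * M" "\<bar>grad ?\<psi> x $ 2\<bar> \<le> M"
        proof -
          have "\<bar>a * b\<bar> \<le> M" if "\<bar>a\<bar> \<le> M" "0 \<le> b" "b \<le> 1" for a b :: real
          proof -
            have "\<bar>a\<bar> * \<bar>b\<bar> \<le> M * 1" using that by (intro mult_mono) auto
            then show ?thesis by (simp add: abs_mult)
          qed
          from this[OF M(2) bump_bounds]
          show "\<bar>grad ?\<psi> x $ 1\<bar> \<le> 2 * M" "\<bar>grad ?\<psi> x $ 2\<bar> \<le> M"
            unfolding grad_def by (simp_all add: partial_corner_bump[OF r(1)] mult.assoc abs_mult[of 2] mult.commute[of "bump _" "bump' _"] del: times_divide_eq_left)
        qed
        have "\<bar>s\<bar> * \<bar>grad ?\<psi> x $ 2\<bar> \<le> s0 * M" using v(2) s0(1) unfolding s by (intro mult_left_mono) auto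
        then have sv: "\<bar>s * grad ?\<psi> x $ 2\<bar> \<le> \<delta> / 2" using s0(2) by (simp add: abs_mult)
        have g2: "\<bar>g x $ 2\<bar> < \<epsilon>" "\<bar>g x $ 2\<bar> < \<delta> / 2" using n[of 2] by (simp_all add: L2)
        have pos: "0 < 1 + g x $ 2" "0 < 1 + (g x + grad ?\<phi> x) $ 2"
          using g2(2) sv \<delta>(2) by (auto simp: grad)
        have "real_shear_density h\<^sub>0 (g x + s *\<^sub>R grad ?\<psi> x) \<le> real_shear_density h\<^sub>0 (g x)
          + (s * (G p $ 1 * grad ?\<psi> x $ 1 + (1 + ederiv 1 h\<^sub>0 1) * grad ?\<psi> x $ 2) + ?K)"
          using g2 n(1)[of 1] s0(2) s(1) v
          by (intro real_shear_density_increment[OF C _ \<delta>(2,3)]) auto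
        then show "0 < 1 + g x $ 2 \<and> 0 < 1 + (g x + grad ?\<phi> x) $ 2 \<and>
          real_shear_density h\<^sub>0 (g x + grad ?\<phi> x) \<le> real_shear_density h\<^sub>0 (g x) + ?k x"
          using pos by (simp add: grad grad_def[of ?\<psi>] \<kappa>_def)
      qed
    qed
  qed simp
  have "(\<lambda>x. \<sigma> x + ?\<phi> x) \<in> admissible h\<^sub>0"
    unfolding admissible_def
  proof (intro CollectI conjI)
    show "(\<lambda>x. \<sigma> x + ?\<phi> x) \<in> W12 (interior Q)" by (rule W12_add_smooth[OF W(1) sm])
    show "zero_trace_on bdryQ1 (\<lambda>x. \<sigma> x + ?\<phi> x)"
    proof (rule zero_trace_on_add_smooth[OF g(1) zt sm])
      fix x assume "x \<in> bdryQ1"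
      then have x: "\<bar>x $ 1\<bar> = 1" by (auto simp: bdryQ1_def)
      \<comment> \<open>The horizontal extent of the box lies within [-1, 1], so points of the
        vertical sides are never strictly inside it and the bump vanishes there.\<close>
      have "l \<in> cbox l u" "u \<in> cbox l u" using lu(3,4) r(1) by (auto simp: mem_cbox_2)
      then have "\<bar>l $ 1\<bar> \<le> 1" "\<bar>u $ 1\<bar> \<le> 1" using lu(1) by (auto simp: Q_eq subset_iff)
      then have "x $ 1 \<le> l $ 1 \<or> u $ 1 \<le> x $ 1" using x by linarith
      then show "?\<phi> x = 0" by (simp add: corner_bump_eq_0[OF r(1) lu(3)])
    qed
    show "shear_energy h\<^sub>0 (\<lambda>x. \<sigma> x + ?\<phi> x) < \<infinity>" using lt W(2) by order
  qed
  with assms(9) lt show False by (simp add: not_less[symmetric])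
qed

end
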